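(* Suppose $Y$ is a path connected CW-complex with countably many cells which is a $K(G,1)$ space. Then $Y$ is path representable.
   Context: A $K(G,1)$ space is a path connected space with fundamental group $G$ and contractible universal cover. Path representability: let $Y$ be a connected, locally path connected Hausdorff space admitting a universal cover. Its diagonal cover is $\widehat Y_{\operatorname{diag}}=C([0,1];Y)/\!\sim$ (quotient of the compact-open topology), where $\alpha\sim\beta$ if $\alpha,\beta$ are homotopic relative to their endpoints, with covering map $P=(P_0,P_1):\widehat Y_{\operatorname{diag}}\to Y\times Y$, $P([\gamma])=(\gamma(0),\gamma(1))$. $Y$ is path representable if $P_0,P_1:\widehat Y_{\operatorname{diag}}\to Y$ are homotopic. *)

theory Defs
  imports "HOL-Analysis.Analysis" "HOL-Algebra.Group"
begin

section \<open>Mapping spaces and quotient topologies\<close>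

text \<open>Continuous maps are represented by functions that are \<^term>\<open>undefined\<close> off the domain, so
  that equality of elements of the mapping space is equality of maps.\<close>

definition continuous_maps :: "'a topology \<Rightarrow> 'b topology \<Rightarrow> ('a \<Rightarrow> 'b) set"
  where "continuous_maps X Y = {f \<in> extensional (topspace X). continuous_map X Y f}"

definition compact_open_topology :: "'a topology \<Rightarrow> 'b topology \<Rightarrow> ('a \<Rightarrow> 'b) topology"
  where "compact_open_topology X Y =
    topology_generated_by
      {{f \<in> continuous_maps X Y. f ` K \<subseteq> U} |K U. compactin X K \<and> openin Y U}"

lemma topspace_compact_open_topology [simp]:
  "topspace (compact_open_topology X Y) = continuous_maps X Y"
proof -
  have "continuous_maps X Y \<in> {{f \<in> continuous_maps X Y. f ` K \<subseteq> U} |K U. compactin X K \<and> openin Y U}"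
    by (rule CollectI, rule exI[of _ "{}"], rule exI[of _ "topspace Y"]) auto
  then show ?thesis
    unfolding compact_open_topology_def topology_generated_by_topspace by blast
qed

definition quotient_topology :: "'a topology \<Rightarrow> ('a \<Rightarrow> 'b) \<Rightarrow> 'b topology"
  where "quotient_topology X q =
    topology (\<lambda>U. U \<subseteq> q ` topspace X \<and> openin X {x \<in> topspace X. q x \<in> U})"

lemma openin_quotient_topology:
  "openin (quotient_topology X q) U \<longleftrightarrow>
     U \<subseteq> q ` topspace X \<and> openin X {x \<in> topspace X. q x \<in> U}"
proof -
  have "istopology (\<lambda>U. U \<subseteq> q ` topspace X \<and> openin X {x \<in> topspace X. q x \<in> U})"
    unfolding istopology_def
  proof (intro conjI allI impI)
    fix S T
    assume "S \<subseteq> q ` topspace X \<and> openin X {x \<in> topspace X. q x \<in> S}"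
      and "T \<subseteq> q ` topspace X \<and> openin X {x \<in> topspace X. q x \<in> T}"
    moreover have "{x \<in> topspace X. q x \<in> S \<inter> T} =
        {x \<in> topspace X. q x \<in> S} \<inter> {x \<in> topspace X. q x \<in> T}"
      by auto
    ultimately show "S \<inter> T \<subseteq> q ` topspace X" "openin X {x \<in> topspace X. q x \<in> S \<inter> T}"
      by auto
  next
    fix \<K>
    assume K: "\<forall>K\<in>\<K>. K \<subseteq> q ` topspace X \<and> openin X {x \<in> topspace X. q x \<in> K}"
    then show "\<Union>\<K> \<subseteq> q ` topspace X" by blast
    have "{x \<in> topspace X. q x \<in> \<Union>\<K>} = (\<Union>K\<in>\<K>. {x \<in> topspace X. q x \<in> K})"
      by auto
    then show "openin X {x \<in> topspace X. q x \<in> \<Union>\<K>}"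
      using K by auto
  qed
  then show ?thesis
    by (simp add: quotient_topology_def topology_inverse')
qed

lemma topspace_quotient_topology [simp]: "topspace (quotient_topology X q) = q ` topspace X"
proof
  show "topspace (quotient_topology X q) \<subseteq> q ` topspace X"
    using openin_quotient_topology[of X q "topspace (quotient_topology X q)"] by simp
  have "{x \<in> topspace X. q x \<in> q ` topspace X} = topspace X" by auto
  then have "openin (quotient_topology X q) (q ` topspace X)"
    by (simp add: openin_quotient_topology)
  then show "q ` topspace X \<subseteq> topspace (quotient_topology X q)"
    by (rule openin_subset)
qed

lemma quotient_map_quotient_topology: "quotient_map X (quotient_topology X q) q"
  by (auto simp: quotient_map_def openin_quotient_topology)


section \<open>Paths, the fundamental group, simple connectedness\<close>

definition path_space :: "'a topology \<Rightarrow> (real \<Rightarrow> 'a) topology"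
  where "path_space Y = compact_open_topology (top_of_set {0..1}) Y"

definition path_homotopic :: "'a topology \<Rightarrow> (real \<Rightarrow> 'a) \<Rightarrow> (real \<Rightarrow> 'a) \<Rightarrow> bool"
  where "path_homotopic Y \<alpha> \<beta> \<longleftrightarrow>
    homotopic_with (\<lambda>h. h 0 = \<alpha> 0 \<and> h 1 = \<alpha> 1) (top_of_set {0..1}) Y \<alpha> \<beta>"

definition path_class :: "'a topology \<Rightarrow> (real \<Rightarrow> 'a) \<Rightarrow> (real \<Rightarrow> 'a) set"
  where "path_class Y \<alpha> = {\<beta> \<in> topspace (path_space Y). path_homotopic Y \<alpha> \<beta>}"

definition path_join :: "(real \<Rightarrow> 'a) \<Rightarrow> (real \<Rightarrow> 'a) \<Rightarrow> real \<Rightarrow> 'a"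
  where "path_join g h =
    restrict (\<lambda>t. if t \<le> 1/2 then g (2 * t) else h (2 * t - 1)) {0..1}"

definition loops_at :: "'a topology \<Rightarrow> 'a \<Rightarrow> (real \<Rightarrow> 'a) set"
  where "loops_at Y y = {g \<in> topspace (path_space Y). g 0 = y \<and> g 1 = y}"

text \<open>In the product below all the classes whose union is taken coincide.\<close>

definition fundamental_group :: "'a topology \<Rightarrow> 'a \<Rightarrow> (real \<Rightarrow> 'a) set monoid"
  where "fundamental_group Y y =
    \<lparr>carrier = path_class Y ` loops_at Y y,
     monoid.mult = (\<lambda>A B. \<Union>g\<in>A. \<Union>h\<in>B. path_class Y (path_join g h)),
     one = path_class Y (restrict (\<lambda>_. y) {0..1})\<rparr>"

definition simply_connected_space :: "'a topology \<Rightarrow> bool"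
  where "simply_connected_space X \<longleftrightarrow>
    path_connected_space X \<and>
    (\<forall>g. pathin X g \<and> g 0 = g 1 \<longrightarrow> path_homotopic X g (\<lambda>_. g 0))"


section \<open>Universal covers\<close>

text \<open>The analogue of \<^const>\<open>covering_space\<close> for abstract topologies.\<close>

definition covering_map :: "'b topology \<Rightarrow> ('b \<Rightarrow> 'a) \<Rightarrow> 'a topology \<Rightarrow> bool"
  where "covering_map E p Y \<longleftrightarrow>
    continuous_map E Y p \<and> p ` topspace E = topspace Y \<and>
    (\<forall>y \<in> topspace Y. \<exists>U. y \<in> U \<and> openin Y U \<and>
       (\<exists>\<V>. \<Union>\<V> = {x \<in> topspace E. p x \<in> U} \<and>
            (\<forall>V \<in> \<V>. openin E V) \<and>
            pairwise disjnt \<V> \<and>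
            (\<forall>V \<in> \<V>. homeomorphic_map (subtopology E V) (subtopology Y U) p)))"

definition universal_cover :: "'b topology \<Rightarrow> ('b \<Rightarrow> 'a) \<Rightarrow> 'a topology \<Rightarrow> bool"
  where "universal_cover E p Y \<longleftrightarrow> covering_map E p Y \<and> simply_connected_space E"

text \<open>Existence of a universal cover has to be stated at some fixed type of points. The type
  \<^typ>\<open>(real \<Rightarrow> 'a) set\<close> is no restriction: by unique path lifting every universal cover, on
  whatever type, is homeomorphic over \<open>Y\<close> to one of this type.\<close>

lemma pathin_lift_unique:
  assumes cov: "covering_map E p Y"
    and g: "pathin E g" and h: "pathin E h" and eq0: "g 0 = h 0"
    and eq: "\<And>t. t \<in> {0..1} \<Longrightarrow> p (g t) = p (h t)" and t: "t \<in> {0..1}"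
  shows "g t = h t"
proof -
  let ?I = "top_of_set {0..1::real}"
  have gc: "continuous_map ?I E g" and hc: "continuous_map ?I E h"
    using g h by (auto simp: pathin_def)
  have loc: "\<exists>W. openin ?I W \<and> s \<in> W \<and> (\<forall>r\<in>W. g r = h r \<longleftrightarrow> g s = h s)"
    if s: "s \<in> {0..1}" for s
  proof -
    have gs: "g s \<in> topspace E" and hs: "h s \<in> topspace E"
      using gc hc s by (auto simp: continuous_map_def)
    then have "p (g s) \<in> topspace Y"
      using cov by (auto simp: covering_map_def)
    then obtain U \<V> where U: "p (g s) \<in> U" and un: "\<Union>\<V> = {x \<in> topspace E. p x \<in> U}"
      and op: "\<And>V. V \<in> \<V> \<Longrightarrow> openin E V" and dis: "pairwise disjnt \<V>"
      and hom: "\<And>V. V \<in> \<V> \<Longrightarrow> homeomorphic_map (subtopology E V) (subtopology Y U) p"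
      using cov unfolding covering_map_def by meson
    have inj: "inj_on p V" if "V \<in> \<V>" for V
    proof -
      have "topspace (subtopology E V) = V"
        using op[OF that] by (simp add: openin_subset Int_absorb1)
      then show ?thesis
        using hom[OF that] by (simp add: homeomorphic_map_def)
    qed
    have "g s \<in> \<Union>\<V>" "h s \<in> \<Union>\<V>"
      using gs hs U eq[OF s] unfolding un by auto
    then obtain V V' where V: "V \<in> \<V>" "g s \<in> V" "V' \<in> \<V>" "h s \<in> V'"
      by blast
    define W where "W = {r \<in> topspace ?I. g r \<in> V} \<inter> {r \<in> topspace ?I. h r \<in> V'}"
    have "openin ?I W"
      unfolding W_def using V op gc hc by (intro openin_Int openin_continuous_map_preimage) auto
    moreover have "s \<in> W"
      using s V by (simp add: W_def)
    moreover have "g r = h r \<longleftrightarrow> g s = h s" if "r \<in> W" for r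
    proof -
      have r: "r \<in> {0..1}" "g r \<in> V" "h r \<in> V'" using that by (auto simp: W_def)
      show ?thesis
      proof (cases "V = V'")
        case True
        then show ?thesis
          using inj[OF V(1)] r V eq[OF r(1)] eq[OF s] by (auto dest: inj_onD)
      next
        case False
        then have "disjnt V V'" using dis V by (simp add: pairwise_def)
        then show ?thesis using r V by (auto simp: disjnt_def)
      qed
    qed
    ultimately show ?thesis by blast
  qed
  let ?S = "{s \<in> {0..1}. g s = h s}"
  have sub: "W \<subseteq> {0..1}" if "openin ?I W" for W
    using openin_subset[OF that] by simp
  have "openin ?I ?S"
    unfolding openin_subopen[of _ ?S]
  proof
    fix s assume s: "s \<in> ?S"
    then obtain W where "openin ?I W" "s \<in> W" "\<forall>r\<in>W. g r = h r \<longleftrightarrow> g s = h s"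
      using loc[of s] by blast
    then show "\<exists>T. openin ?I T \<and> s \<in> T \<and> T \<subseteq> ?S"
      using s sub by (intro exI[of _ W]) blast
  qed
  moreover have "openin ?I ({0..1} - ?S)"
    unfolding openin_subopen[of _ "{0..1} - ?S"]
  proof
    fix s assume s: "s \<in> {0..1} - ?S"
    then obtain W where "openin ?I W" "s \<in> W" "\<forall>r\<in>W. g r = h r \<longleftrightarrow> g s = h s"
      using loc[of s] by blast
    then show "\<exists>T. openin ?I T \<and> s \<in> T \<and> T \<subseteq> {0..1} - ?S"
      using s sub by (intro exI[of _ W]) blast
  qed
  then have "closedin ?I ?S"
    by (auto simp: closedin_def)
  moreover have "connected_space ?I"
    by (simp add: connected_space_subtopology connectedin_iff_connected)
  ultimately have "?S = {} \<or> ?S = {0..1}"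
    unfolding connected_space_clopen_in by (metis topspace_euclidean_subtopology)
  moreover have "0 \<in> ?S" using eq0 by simp
  ultimately have "?S = {0..1}" by (metis empty_iff)
  then have "t \<in> ?S" using t by simp
  then show ?thesis by simp
qed

lemma path_homotopic_compose:
  assumes "path_homotopic X g h" and "continuous_map X Z f"
  shows "path_homotopic Z (f \<circ> g) (f \<circ> h)"
proof -
  have "homotopic_with (\<lambda>k. k 0 = g 0 \<and> k 1 = g 1) (top_of_set {0..1}) X g h"
    using assms(1) unfolding path_homotopic_def .
  then have "homotopic_with (\<lambda>k. k 0 = (f \<circ> g) 0 \<and> k 1 = (f \<circ> g) 1)
      (top_of_set {0..1}) Z (f \<circ> g) (f \<circ> h)"
    using assms(2) by (rule homotopic_with_compose_continuous_map_left) (metis comp_apply)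
  then show ?thesis unfolding path_homotopic_def .
qed

lemma path_homotopic_cong:
  assumes "path_homotopic X g h"
    and "\<And>t. t \<in> {0..1} \<Longrightarrow> g' t = g t" and "\<And>t. t \<in> {0..1} \<Longrightarrow> h' t = h t"
  shows "path_homotopic X g' h'"
proof -
  have e: "g' 0 = g 0" "g' 1 = g 1"
    by (simp_all add: assms(2))
  have "homotopic_with (\<lambda>k. k 0 = g' 0 \<and> k 1 = g' 1) (top_of_set {0..1}) X g h"
    using assms(1) unfolding path_homotopic_def e .
  then show ?thesis
    unfolding path_homotopic_def
  proof (rule homotopic_with_eq)
    fix k l :: "real \<Rightarrow> 'a"
    assume "\<And>t. t \<in> topspace (top_of_set {0..1}) \<Longrightarrow> k t = l t"
    from this[of 0] this[of 1]
    show "(k 0 = g' 0 \<and> k 1 = g' 1) = (l 0 = g' 0 \<and> l 1 = g' 1)" by simp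
  qed (simp_all add: assms(2,3))
qed

lemma universal_cover_homeomorphic_image:
  assumes uc: "universal_cover E p Y" and hm: "homeomorphic_maps E E' f f'"
  shows "universal_cover E' (p \<circ> f') Y"
proof -
  have cov: "covering_map E p Y" and sc: "simply_connected_space E"
    using uc by (auto simp: universal_cover_def)
  have cf: "continuous_map E E' f" and cf': "continuous_map E' E f'"
    and ff: "\<And>x. x \<in> topspace E \<Longrightarrow> f' (f x) = x" and ff': "\<And>x. x \<in> topspace E' \<Longrightarrow> f (f' x) = x"
    using hm unfolding homeomorphic_maps_def by blast+
  have hf': "homeomorphic_map E' E f'"
    using hm homeomorphic_maps_map by blast
  then have fi: "f' ` topspace E' = topspace E"
    by (rule homeomorphic_imp_surjective_map)
  have fo: "f' x \<in> topspace E" if "x \<in> topspace E'" for x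
    using fi that by blast
  have "covering_map E' (p \<circ> f') Y"
    unfolding covering_map_def
  proof (intro conjI ballI)
    show "continuous_map E' Y (p \<circ> f')"
      using cov cf' continuous_map_compose by (auto simp: covering_map_def)
    show "(p \<circ> f') ` topspace E' = topspace Y"
      using cov fi by (metis covering_map_def image_comp)
    fix y assume "y \<in> topspace Y"
    then obtain U \<V> where U: "y \<in> U" "openin Y U" and un: "\<Union>\<V> = {x \<in> topspace E. p x \<in> U}"
      and op: "\<And>V. V \<in> \<V> \<Longrightarrow> openin E V" and dis: "pairwise disjnt \<V>"
      and hom: "\<And>V. V \<in> \<V> \<Longrightarrow> homeomorphic_map (subtopology E V) (subtopology Y U) p"
      using cov unfolding covering_map_def by meson
    define F where "F V = {x \<in> topspace E'. f' x \<in> V}" for V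
    show "\<exists>U. y \<in> U \<and> openin Y U \<and>
       (\<exists>\<V>. \<Union>\<V> = {x \<in> topspace E'. (p \<circ> f') x \<in> U} \<and>
            (\<forall>V \<in> \<V>. openin E' V) \<and>
            pairwise disjnt \<V> \<and>
            (\<forall>V \<in> \<V>. homeomorphic_map (subtopology E' V) (subtopology Y U) (p \<circ> f')))"
    proof (intro exI[of _ U] conjI exI[of _ "F ` \<V>"] ballI U)
      have "x \<in> \<Union>(F ` \<V>) \<longleftrightarrow> x \<in> topspace E' \<and> f' x \<in> \<Union>\<V>" for x
        by (auto simp: F_def)
      then show "\<Union>(F ` \<V>) = {x \<in> topspace E'. (p \<circ> f') x \<in> U}"
        unfolding un using fo by auto
      show "pairwise disjnt (F ` \<V>)"
        using dis by (fastforce simp: pairwise_def disjnt_def F_def)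
      fix V assume "V \<in> F ` \<V>"
      then obtain V0 where V0: "V0 \<in> \<V>" "V = F V0" by blast
      show "openin E' V"
        using V0 op openin_continuous_map_preimage[OF cf'] by (simp add: F_def)
      have "homeomorphic_map (subtopology E' V) (subtopology E V0) f'"
        by (intro homeomorphic_map_subtopologies_alt[OF hf']) (auto simp: F_def V0)
      then show "homeomorphic_map (subtopology E' V) (subtopology Y U) (p \<circ> f')"
        using hom[OF V0(1)] homeomorphic_map_compose by blast
    qed
  qed
  moreover have "simply_connected_space E'"
    unfolding simply_connected_space_def
  proof (intro conjI allI impI)
    show "path_connected_space E'"
      using sc hm homeomorphic_path_connected_space homeomorphic_space_def
      by (metis simply_connected_space_def)
    fix g assume g: "pathin E' g \<and> g 0 = g 1"
    have gin: "g t \<in> topspace E'" if "t \<in> {0..1}" for t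
      using g that by (auto simp: pathin_def continuous_map_def)
    have "pathin E (f' \<circ> g)" using g cf' pathin_compose by blast
    then have "path_homotopic E (f' \<circ> g) (\<lambda>_. (f' \<circ> g) 0)"
      using sc g by (auto simp: simply_connected_space_def)
    from path_homotopic_compose[OF this cf] show "path_homotopic E' g (\<lambda>_. g 0)"
      by (rule path_homotopic_cong) (use gin ff' in auto)
  qed
  ultimately show ?thesis by (simp add: universal_cover_def)
qed

lemma universal_cover_type_irrelevant:
  fixes E :: "'b topology" and Y :: "'a topology"
  assumes uc: "universal_cover E p Y"
  shows "\<exists>(E' :: (real \<Rightarrow> 'a) set topology) f f'.
    homeomorphic_maps E E' f f' \<and> universal_cover E' (p \<circ> f') Y"
proof -
  define e0 where "e0 = (SOME e. e \<in> topspace E)"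
  define f where "f e = {restrict (p \<circ> g) {0..1} |g. pathin E g \<and> g 0 = e0 \<and> g 1 = e}" for e
  have cov: "covering_map E p Y" and pc: "path_connected_space E"
    using uc by (auto simp: universal_cover_def simply_connected_space_def)
  have "inj_on f (topspace E)"
  proof (rule inj_onI)
    fix e e' assume e: "e \<in> topspace E" "e' \<in> topspace E" and fe: "f e = f e'"
    have "e0 \<in> topspace E" unfolding e0_def using e(1) by (rule someI)
    then obtain g where g: "pathin E g" "g 0 = e0" "g 1 = e"
      using pc e by (auto simp: path_connected_space_def)
    then have "restrict (p \<circ> g) {0..1} \<in> f e'"
      unfolding fe[symmetric] by (auto simp: f_def)
    then obtain h where h: "pathin E h" "h 0 = e0" "h 1 = e'"
      and r: "restrict (p \<circ> g) {0..1} = restrict (p \<circ> h) {0..1}"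
      by (auto simp: f_def)
    have "p (g t) = p (h t)" if "t \<in> {0..1}" for t
      using fun_cong[OF r, of t] that by simp
    then have "g 1 = h 1"
      using pathin_lift_unique[OF cov g(1) h(1)] g h by simp
    then show "e = e'" using g h by simp
  qed
  then have "homeomorphic_map E (quotient_topology E f) f"
    by (simp add: homeomorphic_map_def quotient_map_quotient_topology)
  then obtain f' where "homeomorphic_maps E (quotient_topology E f) f f'"
    using homeomorphic_map_maps by blast
  with universal_cover_homeomorphic_image[OF uc] show ?thesis by blast
qed


section \<open>\<open>K(G,1)\<close> spaces and CW complexes\<close>

definition K_G_1_space :: "('g, 'm) monoid_scheme \<Rightarrow> 'a topology \<Rightarrow> bool"
  where "K_G_1_space G Y \<longleftrightarrow>
    path_connected_space Y \<and>
    group G \<and> (\<exists>y \<in> topspace Y. fundamental_group Y y \<cong> G) \<and>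
    (\<exists>(E :: (real \<Rightarrow> 'a) set topology) p. universal_cover E p Y \<and> contractible_space E)"

definition closed_disc :: "nat \<Rightarrow> (nat \<Rightarrow> real) topology"
  where "closed_disc n = subtopology (Euclidean_space n) {x. (\<Sum>i<n. (x i)\<^sup>2) \<le> 1}"

definition disc_interior :: "nat \<Rightarrow> (nat \<Rightarrow> real) set"
  where "disc_interior n = {x \<in> topspace (closed_disc n). (\<Sum>i<n. (x i)\<^sup>2) < 1}"

definition disc_boundary :: "nat \<Rightarrow> (nat \<Rightarrow> real) set"
  where "disc_boundary n = {x \<in> topspace (closed_disc n). (\<Sum>i<n. (x i)\<^sup>2) = 1}"

text \<open>CW structures in the sense of Whitehead: \<open>I\<close> indexes the cells, \<open>d i\<close> is the dimension of
  the cell \<open>i\<close>, and \<open>\<Phi> i\<close> is its characteristic map. The last two clauses are closure-finiteness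
  and the weak topology.\<close>

definition CW_complex ::
    "'a topology \<Rightarrow> 'i set \<Rightarrow> ('i \<Rightarrow> nat) \<Rightarrow> ('i \<Rightarrow> (nat \<Rightarrow> real) \<Rightarrow> 'a) \<Rightarrow> bool"
  where "CW_complex Y I d \<Phi> \<longleftrightarrow>
    Hausdorff_space Y \<and>
    (\<forall>i\<in>I. continuous_map (closed_disc (d i)) Y (\<Phi> i) \<and>
           embedding_map (subtopology (closed_disc (d i)) (disc_interior (d i))) Y (\<Phi> i)) \<and>
    disjoint_family_on (\<lambda>i. \<Phi> i ` disc_interior (d i)) I \<and>
    (\<Union>i\<in>I. \<Phi> i ` disc_interior (d i)) = topspace Y \<and>
    (\<forall>i\<in>I. \<exists>J \<subseteq> I. finite J \<and> (\<forall>j\<in>J. d j < d i) \<and>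
       \<Phi> i ` disc_boundary (d i) \<subseteq> (\<Union>j\<in>J. \<Phi> j ` disc_interior (d j))) \<and>
    (\<forall>A \<subseteq> topspace Y. closedin Y A \<longleftrightarrow>
       (\<forall>i\<in>I. closedin (closed_disc (d i)) {x \<in> topspace (closed_disc (d i)). \<Phi> i x \<in> A}))"


section \<open>Path representability\<close>

definition diagonal_cover :: "'a topology \<Rightarrow> (real \<Rightarrow> 'a) set topology"
  where "diagonal_cover Y = quotient_topology (path_space Y) (path_class Y)"

definition diag_P0 :: "(real \<Rightarrow> 'a) set \<Rightarrow> 'a"
  where "diag_P0 c = the_elem ((\<lambda>\<gamma>. \<gamma> 0) ` c)"

definition diag_P1 :: "(real \<Rightarrow> 'a) set \<Rightarrow> 'a"
  where "diag_P1 c = the_elem ((\<lambda>\<gamma>. \<gamma> 1) ` c)"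

lemma path_homotopic_endpoints:
  assumes "path_homotopic Y \<alpha> \<beta>"
  shows "\<beta> 0 = \<alpha> 0" "\<beta> 1 = \<alpha> 1"
  using homotopic_with_imp_property[OF assms[unfolded path_homotopic_def]] by auto

lemma path_class_self:
  assumes "\<gamma> \<in> topspace (path_space Y)"
  shows "\<gamma> \<in> path_class Y \<gamma>"
  using assms by (auto simp: path_class_def path_homotopic_def path_space_def continuous_maps_def)

lemma diag_P_path_class:
  assumes "\<gamma> \<in> topspace (path_space Y)"
  shows "diag_P0 (path_class Y \<gamma>) = \<gamma> 0" "diag_P1 (path_class Y \<gamma>) = \<gamma> 1"
proof -
  have "\<beta> 0 = \<gamma> 0 \<and> \<beta> 1 = \<gamma> 1" if "\<beta> \<in> path_class Y \<gamma>" for \<beta>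
    using that path_homotopic_endpoints[of Y \<gamma> \<beta>] by (simp add: path_class_def)
  then have "(\<lambda>\<beta>. \<beta> 0) ` path_class Y \<gamma> = (\<lambda>\<beta>. \<gamma> 0) ` path_class Y \<gamma>"
      "(\<lambda>\<beta>. \<beta> 1) ` path_class Y \<gamma> = (\<lambda>\<beta>. \<gamma> 1) ` path_class Y \<gamma>"
    by (simp_all cong: image_cong)
  then have "(\<lambda>\<beta>. \<beta> 0) ` path_class Y \<gamma> = {\<gamma> 0}"
      "(\<lambda>\<beta>. \<beta> 1) ` path_class Y \<gamma> = {\<gamma> 1}"
    using path_class_self[OF assms] by (simp_all add: image_constant)
  then show "diag_P0 (path_class Y \<gamma>) = \<gamma> 0" "diag_P1 (path_class Y \<gamma>) = \<gamma> 1"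
    by (simp_all add: diag_P0_def diag_P1_def)
qed

text \<open>The first four conjuncts are the standing assumptions under which the diagonal cover is
  considered.\<close>

definition path_representable :: "'a topology \<Rightarrow> bool"
  where "path_representable Y \<longleftrightarrow>
    connected_space Y \<and> locally_path_connected_space Y \<and> Hausdorff_space Y \<and>
    (\<exists>(E :: (real \<Rightarrow> 'a) set topology) p. universal_cover E p Y) \<and>
    homotopic_with (\<lambda>_. True) (diagonal_cover Y) Y diag_P0 diag_P1"

end

theory Submission
  imports Defs
begin

text \<open>It suffices to choose in every class \<open>c\<close> of \<^term>\<open>diagonal_cover Y\<close> a path that depends
  continuously on \<open>c\<close>: the chosen paths form a homotopy from \<^const>\<open>diag_P0\<close> to \<^const>\<open>diag_P1\<close>. Over the
  classes starting in an evenly covered open set \<open>U\<close> of \<open>Y\<close>, lift the class to the contractible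
  universal cover \<open>E\<close>, starting from a section over \<open>U\<close>; a contraction of \<open>E\<close> then joins the endpoints
  of the lift in a way that depends only on these endpoints, and it even deforms any other choice of
  path into this one. Running the deformation for time \<open>\<tau> (c 0)\<close>, where \<open>\<tau>\<close> is a bump function
  supported in \<open>U\<close>, one index of a countable locally finite family after the other, glues the local
  choices. Such families exist because a countable CW complex is the direct limit of an increasing
  sequence of compact subsets, so that Tietze extension applies stage by stage.\<close>

section \<open>Countable CW complexes\<close>

lemma continuous_map_locally:
  assumes "\<And>x. x \<in> topspace X \<Longrightarrow> \<exists>U. openin X U \<and> x \<in> U \<and> continuous_map (subtopology X U) Y f"
  shows "continuous_map X Y f"
  by (rule pasting_lemma[where I = "{U. openin X U \<and> continuous_map (subtopology X U) Y f}" and T = id and f = "\<lambda>_. f"])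
     (use assms in auto)

section \<open>Closed discs and the weak topology\<close>

lemma continuous_map_coordinate: "continuous_map (Euclidean_space n) euclideanreal (\<lambda>x. x i)"
  unfolding Euclidean_space_def
  by (intro continuous_map_from_subtopology continuous_map_product_projection) simp

text \<open>The disc is a closed subset of the cube \<open>?K\<close>, which is compact by
  Tychonoff. Coordinates from \<open>n\<close> on are pinned to 0 because
  \<open>Euclidean_space n\<close> sits inside the product of countably many lines.\<close>

lemma compact_closed_disc: "compact_space (closed_disc n)"
proof -
  let ?P = "powertop_real (UNIV :: nat set)"
  let ?K = "PiE UNIV (\<lambda>i. if i < n then {-1..1::real} else {0})"
  have K: "compactin ?P ?K"
    by (simp add: compactin_PiE)
  have "continuous_map ?P euclideanreal (\<lambda>x. \<Sum>i<n. (x i)\<^sup>2)"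
    by (intro continuous_map_sum continuous_map_real_pow continuous_map_product_projection) auto
  then have C: "closedin ?P {x \<in> topspace ?P. (\<Sum>i<n. (x i)\<^sup>2) \<in> {..1}}"
    by (rule closedin_continuous_map_preimage) simp
  have "\<bar>x i\<bar> \<le> 1" if "(\<Sum>i<n. (x i)\<^sup>2) \<le> 1" "i < n" for x :: "nat \<Rightarrow> real" and i
  proof -
    have "(x i)\<^sup>2 \<le> (\<Sum>i<n. (x i)\<^sup>2)"
      using that(2) by (intro member_le_sum) auto
    then show ?thesis
      using that(1) abs_le_square_iff[of "x i" 1] by simp
  qed
  then have eq: "{x \<in> topspace ?P. (\<Sum>i<n. (x i)\<^sup>2) \<in> {..1}} \<inter> ?K =
      {x. \<forall>i\<ge>n. x i = 0} \<inter> {x. (\<Sum>i<n. (x i)\<^sup>2) \<le> 1}"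
    by (auto simp: PiE_iff abs_le_iff split: if_splits)
  have "compactin ?P ({x. \<forall>i\<ge>n. x i = 0} \<inter> {x. (\<Sum>i<n. (x i)\<^sup>2) \<le> 1})"
    using closed_Int_compactin[OF C K] unfolding eq .
  then show ?thesis
    unfolding closed_disc_def Euclidean_space_def
    by (simp add: compactin_subspace subtopology_subtopology)
qed

text \<open>Radial projection retracts Euclidean space onto the disc, and retracts inherit local
  path connectedness.\<close>

lemma locally_path_connected_closed_disc: "locally_path_connected_space (closed_disc n)"
proof -
  \<comment> \<open>The Euclidean norm, cut off below at 1: division by it is continuous and fixes
    every point of the disc.\<close>
  define N where "N x = max 1 (sqrt (\<Sum>i<n. (x i)\<^sup>2))" for x :: "nat \<Rightarrow> real"
  define r where "r x i = (if i < n then x i / N x else 0)" for x :: "nat \<Rightarrow> real" and i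
  have N1: "N x \<ge> 1" for x by (simp add: N_def)
  have "continuous_map (Euclidean_space n) euclideanreal (\<lambda>x. \<Sum>i<n. (x i)\<^sup>2)"
    by (intro continuous_map_sum continuous_map_real_pow continuous_map_coordinate) auto
  then have "continuous_map (Euclidean_space n) euclideanreal (sqrt \<circ> (\<lambda>x. \<Sum>i<n. (x i)\<^sup>2))"
    by (rule continuous_map_compose) (simp add: continuous_on_real_sqrt)
  then have "continuous_map (Euclidean_space n) euclideanreal N"
    unfolding N_def by (intro continuous_map_real_max) (auto simp: o_def)
  then have "continuous_map (Euclidean_space n) (Euclidean_space n) (\<lambda>x i. if i < n then x i / N x else 0)"
    unfolding continuous_map_componentwise_Euclidean_space
    using N1 by (auto intro!: continuous_map_real_divide continuous_map_coordinate) (metis not_one_le_zero)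
  then have rc: "continuous_map (Euclidean_space n) (Euclidean_space n) r"
    unfolding r_def .
  have rs: "(\<Sum>i<n. (r x i)\<^sup>2) \<le> 1" for x
  proof -
    have "(\<Sum>i<n. (r x i)\<^sup>2) = (\<Sum>i<n. (x i)\<^sup>2) / (N x)\<^sup>2"
      by (simp add: r_def power_divide sum_divide_distrib)
    moreover have "(\<Sum>i<n. (x i)\<^sup>2) \<le> (N x)\<^sup>2"
    proof -
      have "sqrt (\<Sum>i<n. (x i)\<^sup>2) \<le> N x" by (simp add: N_def)
      then show ?thesis using N1[of x] by (simp add: real_le_lsqrt sqrt_le_D)
    qed
    ultimately show ?thesis using N1[of x] by (simp add: divide_le_eq)
  qed
  have "retraction_maps (Euclidean_space n) (closed_disc n) r id"
    unfolding retraction_maps_def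
  proof (intro conjI ballI)
    show "continuous_map (Euclidean_space n) (closed_disc n) r"
      unfolding closed_disc_def using rc rs by (intro continuous_map_into_subtopology) auto
    show "continuous_map (closed_disc n) (Euclidean_space n) id"
      unfolding closed_disc_def by (intro continuous_map_from_subtopology) simp
    fix x assume x: "x \<in> topspace (closed_disc n)"
    then have "N x = 1" by (simp add: closed_disc_def N_def)
    with x show "r (id x) = x"
      by (auto simp: r_def closed_disc_def topspace_Euclidean_space)
  qed
  then show ?thesis
    using locally_path_connected_space_retraction_map_image locally_path_connected_Euclidean_space
    unfolding retraction_map_def by blast
qed

text \<open>The weak topology is the quotient topology from the disjoint union of the closed discs.
  Quotient maps then carry local path connectedness from the discs to \<open>Y\<close>.\<close>

lemma CW_complex_quotient_map:
  assumes "CW_complex Y I d \<Phi>"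
  shows "quotient_map (sum_topology (\<lambda>i. closed_disc (d i)) I) Y (\<lambda>(i, x). \<Phi> i x)"
proof -
  have cm: "\<And>i. i \<in> I \<Longrightarrow> continuous_map (closed_disc (d i)) Y (\<Phi> i)"
    and un: "(\<Union>i\<in>I. \<Phi> i ` disc_interior (d i)) = topspace Y"
    and cl: "\<And>A. A \<subseteq> topspace Y \<Longrightarrow> closedin Y A \<longleftrightarrow>
       (\<forall>i\<in>I. closedin (closed_disc (d i)) {x \<in> topspace (closed_disc (d i)). \<Phi> i x \<in> A})"
    using assms unfolding CW_complex_def by blast+
  show ?thesis
    unfolding quotient_map_closedin
  proof (intro conjI allI impI)
    have "\<Phi> i x \<in> topspace Y" if "i \<in> I" "x \<in> topspace (closed_disc (d i))" for i x
      using cm[OF that(1)] that(2) by (auto simp: continuous_map_def)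
    moreover have "disc_interior (d i) \<subseteq> topspace (closed_disc (d i))" for i
      by (auto simp: disc_interior_def)
    ultimately show "(\<lambda>(i, x). \<Phi> i x) ` topspace (sum_topology (\<lambda>i. closed_disc (d i)) I) = topspace Y"
      unfolding un[symmetric] by (fastforce simp: un)
    fix A assume "A \<subseteq> topspace Y"
    moreover have "{x. x \<in> topspace (closed_disc (d i)) \<and> \<Phi> i x \<in> A} =
        {x. (i, x) \<in> {x \<in> topspace (sum_topology (\<lambda>i. closed_disc (d i)) I). (\<lambda>(i, x). \<Phi> i x) x \<in> A}}"
      if "i \<in> I" for i using that by auto
    ultimately show "closedin (sum_topology (\<lambda>i. closed_disc (d i)) I)
        {x \<in> topspace (sum_topology (\<lambda>i. closed_disc (d i)) I). (\<lambda>(i, x). \<Phi> i x) x \<in> A} = closedin Y A"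
      by (auto simp: cl closedin_sum_topology)
  qed
qed

corollary CW_complex_locally_path_connected:
  "CW_complex Y I d \<Phi> \<Longrightarrow> locally_path_connected_space Y"
  by (rule locally_path_connected_space_quotient_map_image[OF CW_complex_quotient_map])
     (simp_all add: locally_path_connected_space_sum_topology locally_path_connected_closed_disc)

section \<open>Direct limits of increasing sequences of compact sets (k-omega spaces in the
  Hausdorff case)\<close>

definition compactly_exhausted :: "'a topology \<Rightarrow> (nat \<Rightarrow> 'a set) \<Rightarrow> bool"
  where "compactly_exhausted Y X \<longleftrightarrow>
    incseq X \<and> (\<forall>n. compactin Y (X n)) \<and> (\<Union>n. X n) = topspace Y \<and>
    (\<forall>A \<subseteq> topspace Y. (\<forall>n. closedin Y (A \<inter> X n)) \<longrightarrow> closedin Y A)"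

text \<open>Stage \<open>X n\<close> collects the images of the finitely many closed discs numbered
  at most \<open>n\<close> in an enumeration of the cells. Every disc maps into a single stage, so a
  set meeting all stages in closed sets has a closed preimage in each disc.\<close>

lemma countable_CW_complex_compactly_exhausted:
  assumes CW: "CW_complex Y I d \<Phi>" and "countable I"
  shows "\<exists>X. compactly_exhausted Y X"
proof -
  have cm: "\<And>i. i \<in> I \<Longrightarrow> continuous_map (closed_disc (d i)) Y (\<Phi> i)"
    and un: "(\<Union>i\<in>I. \<Phi> i ` disc_interior (d i)) = topspace Y"
    and cl: "\<And>A. A \<subseteq> topspace Y \<Longrightarrow> closedin Y A \<longleftrightarrow>
       (\<forall>i\<in>I. closedin (closed_disc (d i)) {x \<in> topspace (closed_disc (d i)). \<Phi> i x \<in> A})"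
    using CW unfolding CW_complex_def by blast+
  let ?D = "\<lambda>i. topspace (closed_disc (d i))"
  define X where "X n = (\<Union>i\<in>{i \<in> I. to_nat_on I i \<le> n}. \<Phi> i ` ?D i)" for n
  have fin: "finite {i \<in> I. to_nat_on I i \<le> n}" for n
  proof (rule finite_imageD[of "to_nat_on I"])
    show "finite (to_nat_on I ` {i \<in> I. to_nat_on I i \<le> n})"
      by (rule finite_subset[of _ "{..n}"]) auto
    show "inj_on (to_nat_on I) {i \<in> I. to_nat_on I i \<le> n}"
      using inj_on_to_nat_on[OF \<open>countable I\<close>] by (rule inj_on_subset) auto
  qed
  have cpt: "compactin Y (X n)" for n
    unfolding X_def using fin cm compact_closed_disc
    by (intro compactin_Union) (auto simp: compact_space_def intro!: image_compactin)
  have mem: "\<Phi> i x \<in> X (to_nat_on I i)" if "i \<in> I" "x \<in> ?D i" for i x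
    using that by (auto simp: X_def)
  have "compactly_exhausted Y X"
    unfolding compactly_exhausted_def
  proof (intro conjI allI impI cpt)
    show "incseq X"
      by (fastforce simp: incseq_def X_def)
    have "topspace Y \<subseteq> (\<Union>n. X n)"
      unfolding un[symmetric] using mem by (fastforce simp: disc_interior_def)
    moreover have "(\<Union>n. X n) \<subseteq> topspace Y"
      using cpt compactin_subset_topspace by blast
    ultimately show "(\<Union>n. X n) = topspace Y" by blast
    fix A assume A: "A \<subseteq> topspace Y" and AX: "\<forall>n. closedin Y (A \<inter> X n)"
    have "closedin (closed_disc (d i)) {x \<in> ?D i. \<Phi> i x \<in> A}" if i: "i \<in> I" for i
    proof -
      have "{x \<in> ?D i. \<Phi> i x \<in> A} = {x \<in> ?D i. \<Phi> i x \<in> A \<inter> X (to_nat_on I i)}"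
        using mem i by auto
      then show ?thesis
        using closedin_continuous_map_preimage[OF cm[OF i], of "A \<inter> X (to_nat_on I i)"] AX by simp
    qed
    then show "closedin Y A" using cl A by blast
  qed
  then show ?thesis by blast
qed

text \<open>The stages are compact, hence closed in the Hausdorff space \<open>Y\<close>. A preimage
  that is closed in a stage is therefore closed in \<open>Y\<close>, and the direct limit topology
  applies.\<close>

lemma compactly_exhausted_continuous_map:
  assumes X: "compactly_exhausted Y X"
    and f: "\<And>n. continuous_map (subtopology Y (X n)) Z f" and H: "Hausdorff_space Y"
  shows "continuous_map Y Z f"
  unfolding continuous_map_closedin
proof (intro conjI allI impI)
  have un: "(\<Union>n. X n) = topspace Y" and cpt: "\<And>n. compactin Y (X n)"
    and cl: "\<And>A. A \<subseteq> topspace Y \<Longrightarrow> (\<And>n. closedin Y (A \<inter> X n)) \<Longrightarrow> closedin Y A"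
    using X by (auto simp: compactly_exhausted_def)
  have tX: "topspace (subtopology Y (X n)) = X n" for n
    using un by auto
  have "f x \<in> topspace Z" if "x \<in> X n" for x n
    using f[of n] that unfolding continuous_map_def tX by blast
  then show "f \<in> topspace Y \<rightarrow> topspace Z"
    unfolding un[symmetric] by blast
  fix C assume C: "closedin Z C"
  show "closedin Y {x \<in> topspace Y. f x \<in> C}"
  proof (rule cl)
    fix n
    have "closedin (subtopology Y (X n)) {x \<in> topspace (subtopology Y (X n)). f x \<in> C}"
      using f C by (rule closedin_continuous_map_preimage)
    then have "closedin Y {x \<in> X n. f x \<in> C}"
      unfolding tX using closedin_trans_full compactin_imp_closedin[OF H cpt] by blast
    moreover have "{x \<in> topspace Y. f x \<in> C} \<inter> X n = {x \<in> X n. f x \<in> C}"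
      using un by auto
    ultimately show "closedin Y ({x \<in> topspace Y. f x \<in> C} \<inter> X n)" by simp
  qed auto
qed

text \<open>Each stage is compact Hausdorff, hence normal. The extension found on
  \<open>X n\<close>, together with \<open>g\<close> on \<open>C\<close>, is extended to
  \<open>X (Suc n)\<close>; the limit of these extensions is continuous because it is so on every
  stage.\<close>

lemma compactly_exhausted_Tietze:
  fixes g :: "'a \<Rightarrow> real"
  assumes X: "compactly_exhausted Y X" and H: "Hausdorff_space Y" and C: "closedin Y C"
    and g: "continuous_map (subtopology Y C) euclideanreal g" and g01: "g ` C \<subseteq> {0..1}"
  obtains f where "continuous_map Y euclideanreal f" "f ` topspace Y \<subseteq> {0..1}" "\<And>x. x \<in> C \<Longrightarrow> f x = g x"
proof -
  have un: "(\<Union>n. X n) = topspace Y" and cpt: "\<And>n. compactin Y (X n)" and inc: "incseq X"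
    using X by (auto simp: compactly_exhausted_def)
  have clX: "closedin Y (X n)" for n
    using compactin_imp_closedin[OF H cpt] .
  have nX: "normal_space (subtopology Y (X n))" for n
    using cpt H by (intro compact_Hausdorff_or_regular_imp_normal_space)
      (auto simp: compactin_subspace Hausdorff_space_subtopology)
  have tX: "topspace (subtopology Y (X n)) = X n" for n
    using un by auto
  define P where "P n f \<longleftrightarrow> continuous_map (subtopology Y (X n)) euclideanreal f \<and> f ` X n \<subseteq> {0..1} \<and>
    (\<forall>x \<in> C \<inter> X n. f x = g x)" for n f
  have "\<exists>F. \<forall>n. P n (F n) \<and> (\<forall>x \<in> X n. F (Suc n) x = F n x)"
  proof (rule dependent_nat_choice)
    have "closedin (subtopology Y (X 0)) (C \<inter> X 0)"
      using C unfolding closedin_subtopology by blast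
    moreover have "continuous_map (subtopology (subtopology Y (X 0)) (C \<inter> X 0)) euclideanreal g"
      unfolding subtopology_subtopology by (rule continuous_map_from_subtopology_mono[OF g]) auto
    ultimately obtain f where "continuous_map (subtopology Y (X 0)) euclideanreal f"
        "f ` topspace (subtopology Y (X 0)) \<subseteq> {0..1}" "\<And>x. x \<in> C \<inter> X 0 \<Longrightarrow> f x = g x"
      using Tietze_extension_realinterval[OF nX, of 0 "C \<inter> X 0" "{0..1}" g] g01
      by (auto simp: is_interval_cc)
    then show "\<exists>f. P 0 f" unfolding P_def tX by blast
  next
    fix f n assume f: "P n f"
    let ?S = "subtopology Y (X (Suc n))"
    \<comment> \<open>On the overlap \<open>C \<inter> X n\<close> both branches agree by
      \<open>P n f\<close>, so pasting along two closed sets makes \<open>?h\<close>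
      continuous.\<close>
    let ?h = "\<lambda>x. if x \<in> X n then f x else g x"
    have XX: "X n \<subseteq> X (Suc n)" using inc by (simp add: incseq_SucD)
    have cl: "closedin Y (X n \<union> (C \<inter> X (Suc n)))"
      using clX C by auto
    then have "closedin ?S (X n \<union> (C \<inter> X (Suc n)))"
      using XX by (simp add: closedin_subset_topspace)
    moreover have "continuous_map (subtopology ?S (X n \<union> (C \<inter> X (Suc n)))) euclideanreal ?h"
      (is "continuous_map ?T _ _")
    proof (rule pasting_lemma_closed[where I = UNIV and T = "\<lambda>b. if b then X n else C \<inter> X (Suc n)"
          and f = "\<lambda>b. if b then f else g"])
      have T: "?T = subtopology Y (X n \<union> (C \<inter> X (Suc n)))"
        using XX by (simp add: subtopology_subtopology inf.absorb2)
      fix b :: bool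
      show "closedin ?T (if b then X n else C \<inter> X (Suc n))"
        unfolding T using clX C by (auto intro!: closedin_subset_topspace)
      have "continuous_map (subtopology ?T (X n)) euclideanreal f"
        unfolding T subtopology_subtopology
        by (rule continuous_map_from_subtopology_mono[of _ "X n"]) (use f in \<open>auto simp: P_def\<close>)
      moreover have "continuous_map (subtopology ?T (C \<inter> X (Suc n))) euclideanreal g"
        unfolding T subtopology_subtopology by (rule continuous_map_from_subtopology_mono[OF g]) auto
      ultimately show "continuous_map (subtopology ?T (if b then X n else C \<inter> X (Suc n))) euclideanreal (if b then f else g)"
        by simp
    qed (use f XX in \<open>auto simp: P_def split: if_splits\<close>)
    moreover have "?h ` (X n \<union> (C \<inter> X (Suc n))) \<subseteq> {0..1}"
      using f g01 by (auto simp: P_def image_subset_iff)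
    ultimately obtain f' where "continuous_map ?S euclideanreal f'" "f' ` topspace ?S \<subseteq> {0..1}"
        "\<And>x. x \<in> X n \<union> (C \<inter> X (Suc n)) \<Longrightarrow> f' x = ?h x"
      using Tietze_extension_realinterval[OF nX, of "Suc n" "X n \<union> (C \<inter> X (Suc n))" "{0..1}" ?h]
      by (auto simp: is_interval_cc)
    then show "\<exists>f'. P (Suc n) f' \<and> (\<forall>x \<in> X n. f' x = f x)"
      using f unfolding P_def tX by (intro exI[of _ f']) auto
  qed
  then obtain F where P: "\<And>n. P n (F n)" and FS: "\<And>n x. x \<in> X n \<Longrightarrow> F (Suc n) x = F n x"
    by blast
  \<comment> \<open>Any stage containing \<open>x\<close> gives the same value, since later
    functions \<open>F\<close> extend the earlier ones.\<close>
  define f where "f x = F (LEAST n. x \<in> X n) x" for x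
  have F: "F m x = F n x" if "n \<le> m" "x \<in> X n" for m n x
    using that(1)
  proof (induction rule: dec_induct)
    case (step k)
    then have "x \<in> X k" using inc that(2) by (meson incseqD subsetD)
    with step FS show ?case by simp
  qed simp
  have fF: "f x = F n x" if "x \<in> X n" for n x
    unfolding f_def by (rule sym, rule F[OF Least_le[of "\<lambda>n. x \<in> X n", OF that] LeastI[of "\<lambda>n. x \<in> X n", OF that]])
  show thesis
  proof
    show "continuous_map Y euclideanreal f"
    proof (rule compactly_exhausted_continuous_map[OF X _ H])
      show "continuous_map (subtopology Y (X n)) euclideanreal f" for n
        using P[of n] unfolding P_def by (elim conjE, elim continuous_map_eq) (metis tX fF)
    qed
    show "f ` topspace Y \<subseteq> {0..1}"
    proof -
      have "f x \<in> {0..1}" if "x \<in> X n" for x n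
        using P[of n] fF[OF that] that by (auto simp: P_def image_subset_iff)
      then show ?thesis unfolding un[symmetric] by blast
    qed
    fix x assume "x \<in> C"
    then obtain n where "x \<in> X n" using closedin_subset[OF C] un by blast
    then show "f x = g x" using \<open>x \<in> C\<close> P[of n] fF by (simp add: P_def)
  qed
qed

section \<open>Bump functions and countable locally finite families\<close>

lemma compactly_exhausted_bump_function:
  assumes X: "compactly_exhausted Y X" and H: "Hausdorff_space Y" and U: "openin Y U" "y \<in> U"
  obtains f where "continuous_map Y euclideanreal f" "f ` topspace Y \<subseteq> {0..1}" "f y = 1"
    "\<And>x. x \<in> topspace Y - U \<Longrightarrow> f x = 0"
proof -
  \<comment> \<open>The two pieces of \<open>?C\<close> are closed, and disjoint because
    \<open>y\<close> lies in \<open>U\<close>. Hence \<open>?g\<close> is continuous on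
    \<open>?C\<close>, and Tietze extends it to the bump function.\<close>
  let ?C = "insert y (topspace Y - U)"
  let ?g = "\<lambda>x. if x = y then 1 else 0 :: real"
  have y: "y \<in> topspace Y" using U openin_subset by blast
  have "closedin Y {y}" using H y by (simp add: closedin_Hausdorff_sing_eq)
  then have "closedin Y ({y} \<union> (topspace Y - U))"
    using U by blast
  then have C: "closedin Y ?C" by simp
  have "continuous_map (subtopology Y ?C) euclideanreal ?g"
  proof (rule pasting_lemma_closed[where I = UNIV and T = "\<lambda>b. if b then {y} else topspace Y - U" and f = "\<lambda>b _. if b then 1 else 0"])
    show "closedin (subtopology Y ?C) (if b then {y} else topspace Y - U)" for b :: bool
      using \<open>closedin Y {y}\<close> U by (auto intro!: closedin_subset_topspace)
  qed (use U in \<open>auto split: if_splits\<close>)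
  moreover have "?g ` ?C \<subseteq> {0..1}" by auto
  ultimately obtain f where f: "continuous_map Y euclideanreal f" "f ` topspace Y \<subseteq> {0..1}" "\<And>x. x \<in> ?C \<Longrightarrow> f x = ?g x"
    using compactly_exhausted_Tietze[OF X H C, of ?g] by blast
  show thesis
    by (rule that[OF f(1,2)]) (use f(3) U in auto)
qed

lemma compactly_exhausted_Lindelof:
  assumes X: "compactly_exhausted Y X"
  shows "Lindelof_space Y"
proof -
  have un: "(\<Union>n. X n) = topspace Y" and cpt: "\<And>n. compactin Y (X n)"
    using X by (auto simp: compactly_exhausted_def)
  have "Lindelof_space (subtopology Y (\<Union>(range X)))"
    using cpt by (intro Lindelof_space_Union) (auto simp: compactin_subspace compact_imp_Lindelof_space)
  then show ?thesis using un by (simp add: subtopology_topspace)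
qed

text \<open>Mather's trick: multiplying the \<open>n\<close>-th bump function by cutoffs of the earlier ones makes a
  countable family locally finite.\<close>

lemma compactly_exhausted_locally_finite_bumps:
  assumes X: "compactly_exhausted Y X" and H: "Hausdorff_space Y" and ne: "topspace Y \<noteq> {}"
    and U: "\<And>y. y \<in> topspace Y \<Longrightarrow> openin Y (U y) \<and> y \<in> U y"
  obtains z :: "nat \<Rightarrow> 'a" and \<tau> :: "nat \<Rightarrow> 'a \<Rightarrow> real" and S :: "nat \<Rightarrow> 'a set"
  where "\<And>n. z n \<in> topspace Y" "\<And>n. continuous_map Y euclideanreal (\<tau> n)"
    "\<And>n y. \<tau> n y \<in> {0..1}"
    "\<And>n. closedin Y (S n)" "\<And>n. S n \<subseteq> U (z n)" "\<And>n y. y \<in> topspace Y - S n \<Longrightarrow> \<tau> n y = 0"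
    "\<And>y. y \<in> topspace Y \<Longrightarrow> \<exists>N n. openin Y N \<and> y \<in> N \<and> (\<forall>x\<in>N. \<tau> n x = 1)"
    "\<And>y. y \<in> topspace Y \<Longrightarrow> \<exists>N m. openin Y N \<and> y \<in> N \<and> (\<forall>n\<ge>m. \<forall>x\<in>N. \<tau> n x = 0)"
proof -
  have "\<exists>f. continuous_map Y euclideanreal f \<and> f y = 1 \<and> (\<forall>x \<in> topspace Y - U y. f x = (0::real))"
    if "y \<in> topspace Y" for y
    using compactly_exhausted_bump_function[OF X H, of "U y" y] U[OF that] by metis
  then obtain b :: "'a \<Rightarrow> 'a \<Rightarrow> real" where b: "\<And>y. y \<in> topspace Y \<Longrightarrow> continuous_map Y euclideanreal (b y)"
    "\<And>y. y \<in> topspace Y \<Longrightarrow> b y y = 1" "\<And>y x. \<lbrakk>y \<in> topspace Y; x \<in> topspace Y - U y\<rbrakk> \<Longrightarrow> b y x = 0"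
    by metis
  \<comment> \<open>The level 3/4 is where the cutoff \<open>\<psi>\<close> below reaches 0.\<close>
  define W where "W y = {x \<in> topspace Y. b y x \<in> {3/4<..}}" for y
  have "openin Y (W y)" if "y \<in> topspace Y" for y
    unfolding W_def by (rule openin_continuous_map_preimage[OF b(1)[OF that]]) auto
  moreover have "\<Union>(W ` topspace Y) = topspace Y"
    using b(2) by (force simp: W_def)
  ultimately have "\<exists>\<V>. countable \<V> \<and> \<V> \<subseteq> W ` topspace Y \<and> \<Union>\<V> = topspace Y"
    by (intro Lindelof_spaceD[OF compactly_exhausted_Lindelof[OF X]]) auto
  then obtain \<V> where \<V>: "countable \<V>" "\<V> \<subseteq> W ` topspace Y" "\<Union>\<V> = topspace Y"
    by (elim exE conjE)
  obtain C where C: "countable C" "C \<subseteq> topspace Y" "\<V> = W ` C"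
    using countable_subset_image[THEN iffD1, OF conjI[OF \<V>(1,2)]] by (elim exE conjE)
  have "C \<noteq> {}" using ne \<V>(3) C(3) by (metis Sup_empty image_empty)
  define z where "z = from_nat_into C"
  have zC: "range z = C" unfolding z_def using C(1) \<open>C \<noteq> {}\<close> by (rule range_from_nat_into[rotated])
  then have z: "z n \<in> topspace Y" for n using C(2) by blast
  define f where "f n = b (z n)" for n
  have fc: "continuous_map Y euclideanreal (f n)" for n
    unfolding f_def using b(1) z by blast
  have f0: "f n x = 0" if "x \<in> topspace Y - U (z n)" for n x
    unfolding f_def using b(3) z that by blast
  have cover: "\<exists>n. f n x > 3/4" if "x \<in> topspace Y" for x
  proof -
    have "x \<in> \<Union>(W ` range z)" using that \<V>(3) C(3) zC by simp
    then show ?thesis by (auto simp: f_def W_def)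
  qed
  \<comment> \<open>\<open>\<phi>\<close> rises from 0 at 1/4 to 1 at 1/2, and \<open>\<psi>\<close>
    falls from 1 at 5/8 to 0 at 3/4. The gap between 1/2 and 5/8 leaves room for the open
    neighbourhood on which one of the \<open>\<tau> n\<close> is 1.\<close>
  define \<phi> where "\<phi> r = max 0 (min 1 (4 * r - 1))" for r :: real
  define \<psi> where "\<psi> r = max 0 (min 1 (6 - 8 * r))" for r :: real
  define \<tau> where "\<tau> n x = \<phi> (f n x) * (\<Prod>k<n. \<psi> (f k x))" for n x
  \<comment> \<open>\<open>S n\<close> is closed and contains all points of \<open>Y\<close> with
    \<open>\<phi> (f n x)\<close> nonzero. It lies in \<open>U (z n)\<close> because
    \<open>f n\<close> vanishes on the rest of \<open>Y\<close>.\<close>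
  define S where "S n = {x \<in> topspace Y. f n x \<in> {1/4..}}" for n
  have fopen: "openin Y {x \<in> topspace Y. f n x \<in> A}" if "open A" for n A
    using openin_continuous_map_preimage[OF fc, of A n] that by simp
  show thesis
  proof
    show "z n \<in> topspace Y" for n by (rule z)
    show "continuous_map Y euclideanreal (\<tau> n)" for n
      unfolding \<tau>_def \<phi>_def \<psi>_def
      by (intro continuous_map_real_mult continuous_map_prod continuous_map_real_max
          continuous_map_real_min continuous_map_diff fc continuous_map_real_mult_left) auto
    show "\<tau> n y \<in> {0..1}" for n y
    proof -
      have "0 \<le> (\<Prod>k<n. \<psi> (f k y))" "(\<Prod>k<n. \<psi> (f k y)) \<le> 1"
        by (auto simp: \<psi>_def intro!: prod_nonneg prod_le_1)
      then show ?thesis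
        by (auto simp: \<tau>_def \<phi>_def intro!: mult_le_one)
    qed
    show "closedin Y (S n)" for n
      unfolding S_def by (rule closedin_continuous_map_preimage[OF fc]) auto
    show "S n \<subseteq> U (z n)" for n
      using f0[of _ n] by (force simp: S_def)
    show "\<tau> n y = 0" if "y \<in> topspace Y - S n" for n y
      using that by (auto simp: \<tau>_def \<phi>_def S_def)
    fix y assume y: "y \<in> topspace Y"
    obtain k where k: "f k y > 3/4" using cover[OF y] by blast
    show "\<exists>N m. openin Y N \<and> y \<in> N \<and> (\<forall>n\<ge>m. \<forall>x\<in>N. \<tau> n x = 0)"
    proof (intro exI conjI allI impI ballI)
      show "openin Y {x \<in> topspace Y. f k x \<in> {3/4<..}}" by (rule fopen) simp
      \<comment> \<open>From \<open>Suc k\<close> on, the product in \<open>\<tau> n\<close>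
        contains the factor \<open>\<psi> (f k x)\<close>, which is 0 on this neighbourhood.\<close>
      fix n x assume "Suc k \<le> n" "x \<in> {x \<in> topspace Y. f k x \<in> {3/4<..}}"
      then have "k < n" "\<psi> (f k x) = 0" by (auto simp: \<psi>_def)
      then have "(\<Prod>k<n. \<psi> (f k x)) = 0" by auto
      then show "\<tau> n x = 0" by (simp add: \<tau>_def)
    qed (use k y in simp)
    \<comment> \<open>For the first index with value above 1/2 all earlier values are at most 1/2.
      So near \<open>y\<close> the earlier cutoffs are 1, while \<open>\<phi>\<close> of the present
      value is 1.\<close>
    define n where "n = (LEAST n. f n y > 1/2)"
    have "f n y > 1/2" unfolding n_def by (rule LeastI[of _ k]) (use k in simp)
    moreover have "f j y < 5/8" if "j < n" for j
      using not_less_Least[OF that[unfolded n_def]] by simp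
    ultimately have yN: "y \<in> {x \<in> topspace Y. f n x \<in> {1/2<..}} \<inter> (\<Inter>j\<in>{..<n}. {x \<in> topspace Y. f j x \<in> {..<5/8}})"
      (is "y \<in> ?A \<inter> ?B") using y by auto
    show "\<exists>N n. openin Y N \<and> y \<in> N \<and> (\<forall>x\<in>N. \<tau> n x = 1)"
    proof (intro exI conjI ballI)
      have "openin Y (?A \<inter> ?B)"
      proof (cases "n = 0")
        case True
        then show ?thesis using fopen[of "{1/2<..}" n] by simp
      next
        case False
        then have "openin Y ?B" by (intro openin_Inter) (auto intro!: fopen simp del: lessThan_iff)
        then show ?thesis using fopen[of "{1/2<..}" n] by (intro openin_Int) auto
      qed
      then show "openin Y (?A \<inter> ?B)" .
      fix x assume x: "x \<in> ?A \<inter> ?B"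
      then have "\<psi> (f j x) = 1" if "j < n" for j using that by (force simp: \<psi>_def)
      moreover have "\<phi> (f n x) = 1" using x by (simp add: \<phi>_def)
      ultimately show "\<tau> n x = 1" by (simp add: \<tau>_def)
    qed (rule yN)
  qed
qed

section \<open>Lifting homotopies through coverings\<close>

text \<open>\<open>V\<close> is the sheet through \<open>e\<close>, and \<open>s\<close> inverts
  \<open>p\<close> on it. \<open>U\<close> is obtained before \<open>e\<close>, so the same
  neighbourhood serves all points above it.\<close>

lemma covering_map_local_sections:
  assumes cov: "covering_map E p Y" and y: "y \<in> topspace Y"
  obtains U where "openin Y U" "y \<in> U"
    "\<And>e. \<lbrakk>e \<in> topspace E; p e \<in> U\<rbrakk> \<Longrightarrow> \<exists>V s. openin E V \<and> e \<in> V \<and>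
       continuous_map (subtopology Y U) E s \<and> (\<forall>u\<in>U. p (s u) = u) \<and> (\<forall>v\<in>V. s (p v) = v)"
proof -
  obtain U \<V> where U: "y \<in> U" "openin Y U" and un: "\<Union>\<V> = {x \<in> topspace E. p x \<in> U}"
    and op: "\<And>V. V \<in> \<V> \<Longrightarrow> openin E V"
    and hom: "\<And>V. V \<in> \<V> \<Longrightarrow> homeomorphic_map (subtopology E V) (subtopology Y U) p"
    using cov y unfolding covering_map_def by meson
  show thesis
  proof (rule that[OF U(2,1)])
    fix e assume "e \<in> topspace E" "p e \<in> U"
    then obtain V where V: "V \<in> \<V>" "e \<in> V" using un by blast
    have tV: "topspace (subtopology E V) = V" and tU: "topspace (subtopology Y U) = U"
      using op[OF V(1)] U(2) openin_subset by (auto simp: Int_absorb1)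
    obtain s where "homeomorphic_maps (subtopology E V) (subtopology Y U) p s"
      using hom[OF V(1)] homeomorphic_map_maps by blast
    then have "continuous_map (subtopology Y U) E s" "\<forall>u\<in>U. p (s u) = u" "\<forall>v\<in>V. s (p v) = v"
      unfolding homeomorphic_maps_def tV tU using continuous_map_into_fulltopology by blast+
    then show "\<exists>V s. openin E V \<and> e \<in> V \<and>
       continuous_map (subtopology Y U) E s \<and> (\<forall>u\<in>U. p (s u) = u) \<and> (\<forall>v\<in>V. s (p v) = v)"
      using op V by blast
  qed
qed

text \<open>Bisection of the time interval by \<open>Bolzano\<close> takes the place of a
  subdivision with a Lebesgue number. A short interval is lifted by a single section of
  \<open>p\<close>, and adjacent lifts are joined after shrinking the neighbourhood of
  \<open>w0\<close>.\<close>

lemma covering_map_local_homotopy_lift: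
  fixes F :: "real \<times> 'w \<Rightarrow> 'a"
  assumes cov: "covering_map E p Y"
    and F: "continuous_map (prod_topology (top_of_set {0..1}) W) Y F"
    and f: "continuous_map W E f" and pf: "\<And>w. w \<in> topspace W \<Longrightarrow> p (f w) = F (0, w)"
    and w0: "w0 \<in> topspace W"
  obtains N G where "openin W N" "w0 \<in> N"
    "continuous_map (prod_topology (top_of_set {0..1}) (subtopology W N)) E G"
    "\<And>w. w \<in> N \<Longrightarrow> G (0, w) = f w"
    "\<And>t w. \<lbrakk>t \<in> {0..1}; w \<in> N\<rbrakk> \<Longrightarrow> p (G (t, w)) = F (t, w)"
proof -
  let ?R = "prod_topology euclideanreal W"
  have F': "continuous_map (subtopology ?R ({0..1} \<times> topspace W)) Y F"
    using F by (simp add: subtopology_Times subtopology_topspace)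
  \<comment> \<open>\<open>Q a b\<close> says that any initial lift at time \<open>a\<close> near
    \<open>w0\<close> can be continued to time \<open>b\<close> over a smaller neighbourhood.
    Quantifying over all initial lifts makes \<open>Q\<close> additive over adjacent
    intervals.\<close>
  define Q where "Q a b \<longleftrightarrow> 0 \<le> a \<and> b \<le> 1 \<longrightarrow>
    (\<forall>N f. openin W N \<and> w0 \<in> N \<and> continuous_map (subtopology W N) E f \<and> (\<forall>w\<in>N. p (f w) = F (a, w)) \<longrightarrow>
      (\<exists>N' G. openin W N' \<and> w0 \<in> N' \<and> N' \<subseteq> N \<and> continuous_map (subtopology ?R ({a..b} \<times> N')) E G \<and>
        (\<forall>w\<in>N'. G (a, w) = f w) \<and> (\<forall>t\<in>{a..b}. \<forall>w\<in>N'. p (G (t, w)) = F (t, w))))" for a b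
  have "Q 0 1"
  proof (rule Bolzano)
    fix a b c assume Q: "Q a b" "Q b c" and le: "a \<le> b" "b \<le> c"
    show "Q a c"
      unfolding Q_def
    proof (intro impI allI)
      fix N f
      assume ac: "0 \<le> a \<and> c \<le> 1"
        and N: "openin W N \<and> w0 \<in> N \<and> continuous_map (subtopology W N) E f \<and> (\<forall>w\<in>N. p (f w) = F (a, w))"
      obtain N1 G1 where N1: "openin W N1" "w0 \<in> N1" "N1 \<subseteq> N"
        and G1: "continuous_map (subtopology ?R ({a..b} \<times> N1)) E G1"
          "\<forall>w\<in>N1. G1 (a, w) = f w" "\<forall>t\<in>{a..b}. \<forall>w\<in>N1. p (G1 (t, w)) = F (t, w)"
        using Q(1)[unfolded Q_def, rule_format, OF _ N] ac le by auto
      have "continuous_map (subtopology W N1) (prod_topology (top_of_set {a..b}) (subtopology W N1)) (\<lambda>w. (b, w))"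
        using le by (intro continuous_map_pairedI) auto
      then have "continuous_map (subtopology W N1) E (G1 \<circ> (\<lambda>w. (b, w)))"
        using G1(1) unfolding subtopology_Times by (rule continuous_map_compose)
      then obtain N2 G2 where N2: "openin W N2" "w0 \<in> N2" "N2 \<subseteq> N1"
        and G2: "continuous_map (subtopology ?R ({b..c} \<times> N2)) E G2"
          "\<forall>w\<in>N2. G2 (b, w) = G1 (b, w)" "\<forall>t\<in>{b..c}. \<forall>w\<in>N2. p (G2 (t, w)) = F (t, w)"
        using Q(2)[unfolded Q_def, rule_format, of N1 "G1 \<circ> (\<lambda>w. (b, w))"] ac le N1 G1(3) by auto
      \<comment> \<open>The second lift starts from the final values of the first, so both agree at
        time \<open>b\<close>.\<close>
      let ?G = "\<lambda>x. if fst x \<le> b then G1 x else G2 x"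
      have "continuous_map (subtopology ?R ({a..c} \<times> N2)) E ?G"
      proof (rule continuous_map_cases_le)
        show "continuous_map (subtopology ?R ({a..c} \<times> N2)) euclideanreal fst"
          by (intro continuous_map_from_subtopology continuous_map_fst)
        show "continuous_map (subtopology (subtopology ?R ({a..c} \<times> N2))
            {x \<in> topspace (subtopology ?R ({a..c} \<times> N2)). fst x \<le> b}) E G1"
          unfolding subtopology_subtopology
          by (rule continuous_map_from_subtopology_mono[OF G1(1)]) (use N2 in auto)
        show "continuous_map (subtopology (subtopology ?R ({a..c} \<times> N2))
            {x \<in> topspace (subtopology ?R ({a..c} \<times> N2)). b \<le> fst x}) E G2"
          unfolding subtopology_subtopology
          by (rule continuous_map_from_subtopology_mono[OF G2(1)]) (use N2 in auto)
      qed (use G2 in auto)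
      moreover have "\<forall>w\<in>N2. ?G (a, w) = f w" using G1(2) N2 le by auto
      moreover have "\<forall>t\<in>{a..c}. \<forall>w\<in>N2. p (?G (t, w)) = F (t, w)" using G1(3) G2(3) N2 by auto
      ultimately show "\<exists>N' G. openin W N' \<and> w0 \<in> N' \<and> N' \<subseteq> N \<and> continuous_map (subtopology ?R ({a..c} \<times> N')) E G \<and>
        (\<forall>w\<in>N'. G (a, w) = f w) \<and> (\<forall>t\<in>{a..c}. \<forall>w\<in>N'. p (G (t, w)) = F (t, w))"
        using N1 N2 by (intro exI[of _ N2] exI[of _ ?G]) blast
    qed
  next
    fix x :: real assume x: "0 \<le> x" "x \<le> 1"
    let ?I = "top_of_set {0..1::real}"
    have "F (x, w0) \<in> topspace Y"
      using F x w0 by (auto simp: continuous_map_def)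
    then obtain U where U: "openin Y U" "F (x, w0) \<in> U"
      and sec: "\<And>e. \<lbrakk>e \<in> topspace E; p e \<in> U\<rbrakk> \<Longrightarrow> \<exists>V s. openin E V \<and> e \<in> V \<and>
         continuous_map (subtopology Y U) E s \<and> (\<forall>u\<in>U. p (s u) = u) \<and> (\<forall>v\<in>V. s (p v) = v)"
      using covering_map_local_sections[OF cov] by metis
    \<comment> \<open>A box around \<open>(x, w0)\<close> inside \<open>?P\<close> is mapped by
      \<open>F\<close> into one evenly covered set, where a section composed with \<open>F\<close>
      is a lift.\<close>
    let ?P = "{z \<in> topspace (prod_topology ?I W). F z \<in> U}"
    have "openin (prod_topology ?I W) ?P"
      by (rule openin_continuous_map_preimage[OF F U(1)])
    moreover have "(x, w0) \<in> ?P"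
      using x w0 U by simp
    ultimately have "\<exists>J M. openin ?I J \<and> openin W M \<and> x \<in> J \<and> w0 \<in> M \<and> J \<times> M \<subseteq> ?P"
      by (simp only: openin_prod_topology_alt)
    then obtain J M where J: "openin ?I J" "x \<in> J" and M: "openin W M" "w0 \<in> M" and JM: "J \<times> M \<subseteq> ?P"
      by blast
    obtain \<delta> where \<delta>: "\<delta> > 0" "ball x \<delta> \<inter> {0..1} \<subseteq> J"
      using J by (metis openin_contains_ball)
    show "\<exists>d>0. \<forall>a b. a \<le> x \<and> x \<le> b \<and> b - a < d \<longrightarrow> Q a b"
    proof (intro exI conjI allI impI)
      fix a b assume ab: "a \<le> x \<and> x \<le> b \<and> b - a < \<delta>"
      show "Q a b"
        unfolding Q_def
      proof (intro impI allI)
        fix N f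
        assume ab01: "0 \<le> a \<and> b \<le> 1"
          and N: "openin W N \<and> w0 \<in> N \<and> continuous_map (subtopology W N) E f \<and> (\<forall>w\<in>N. p (f w) = F (a, w))"
        have "{a..b} \<subseteq> J" using \<delta> ab ab01 by (force simp: dist_real_def)
        then have FU: "F (t, w) \<in> U" if "t \<in> {a..b}" "w \<in> M" for t w
          using JM that by blast
        have tN: "topspace (subtopology W N) = N" using N openin_subset by fastforce
        have "f w0 \<in> topspace E" using N tN by (auto simp: continuous_map_def)
        moreover have "p (f w0) \<in> U" using N FU[of a w0] M ab by auto
        ultimately obtain V s where V: "openin E V" "f w0 \<in> V"
          and s: "continuous_map (subtopology Y U) E s" "\<forall>u\<in>U. p (s u) = u" "\<forall>v\<in>V. s (p v) = v"
          using sec by blast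
        \<comment> \<open>Keeping \<open>f w\<close> in the sheet \<open>V\<close> of
          \<open>f w0\<close> ensures that the lift \<open>s \<circ> F\<close> starts at
          \<open>f w\<close>.\<close>
        let ?N = "M \<inter> {w \<in> N. f w \<in> V}"
        have "openin (subtopology W N) {w \<in> topspace (subtopology W N). f w \<in> V}"
          using N V by (intro openin_continuous_map_preimage) auto
        then have "openin W {w \<in> N. f w \<in> V}"
          unfolding tN using N openin_trans_full by blast
        then have op: "openin W ?N" using M by blast
        have "continuous_map (subtopology ?R ({a..b} \<times> ?N)) Y F"
          by (rule continuous_map_from_subtopology_mono[OF F']) (use ab01 openin_subset[OF M(1)] in auto)
        then have "continuous_map (subtopology ?R ({a..b} \<times> ?N)) (subtopology Y U) F"
          by (rule continuous_map_into_subtopology) (use FU in auto)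
        then have "continuous_map (subtopology ?R ({a..b} \<times> ?N)) E (s \<circ> F)"
          using s(1) by (rule continuous_map_compose)
        moreover have "\<forall>w\<in>?N. (s \<circ> F) (a, w) = f w"
        proof
          fix w assume "w \<in> ?N"
          then have "s (p (f w)) = f w" "p (f w) = F (a, w)" using N s(3) by blast+
          then show "(s \<circ> F) (a, w) = f w" by simp
        qed
        moreover have "\<forall>t\<in>{a..b}. \<forall>w\<in>?N. p ((s \<circ> F) (t, w)) = F (t, w)"
          using FU s(2) by auto
        ultimately show "\<exists>N' G. openin W N' \<and> w0 \<in> N' \<and> N' \<subseteq> N \<and> continuous_map (subtopology ?R ({a..b} \<times> N')) E G \<and>
            (\<forall>w\<in>N'. G (a, w) = f w) \<and> (\<forall>t\<in>{a..b}. \<forall>w\<in>N'. p (G (t, w)) = F (t, w))"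
          using op N V M by (intro exI[of _ ?N] exI[of _ "s \<circ> F"]) blast
      qed
    qed (rule \<delta>)
  qed simp
  moreover have "openin W (topspace W) \<and> w0 \<in> topspace W \<and>
      continuous_map (subtopology W (topspace W)) E f \<and> (\<forall>w\<in>topspace W. p (f w) = F (0, w))"
    using w0 f pf by (simp add: subtopology_topspace)
  ultimately obtain N G where "openin W N" "w0 \<in> N" "continuous_map (subtopology ?R ({0..1} \<times> N)) E G" "\<forall>w\<in>N. G (0, w) = f w"
      "\<forall>t\<in>{0..1}. \<forall>w\<in>N. p (G (t, w)) = F (t, w)"
    unfolding Q_def by (smt (verit, del_insts))
  then show thesis using that by (simp add: subtopology_Times)
qed

text \<open>By unique lifting the choice is determined on \<open>{0..1}\<close> whenever a lift
  exists; values elsewhere are arbitrary.\<close>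

definition path_lift :: "'b topology \<Rightarrow> ('b \<Rightarrow> 'a) \<Rightarrow> 'b \<Rightarrow> (real \<Rightarrow> 'a) \<Rightarrow> real \<Rightarrow> 'b"
  where "path_lift E p e \<beta> = (SOME g. pathin E g \<and> g 0 = e \<and> (\<forall>t\<in>{0..1}. p (g t) = \<beta> t))"

lemma path_lift_unique:
  assumes cov: "covering_map E p Y" and g: "pathin E g" "g 0 = e" "\<And>t. t \<in> {0..1} \<Longrightarrow> p (g t) = \<beta> t"
  shows "pathin E (path_lift E p e \<beta>)" "path_lift E p e \<beta> 0 = e"
    "\<And>t. t \<in> {0..1} \<Longrightarrow> p (path_lift E p e \<beta> t) = \<beta> t"
    "\<And>t. t \<in> {0..1} \<Longrightarrow> path_lift E p e \<beta> t = g t"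
proof -
  let ?l = "path_lift E p e \<beta>"
  have l: "pathin E ?l \<and> ?l 0 = e \<and> (\<forall>t\<in>{0..1}. p (?l t) = \<beta> t)"
    unfolding path_lift_def by (rule someI[of _ g]) (use g in blast)
  then show "pathin E ?l" "?l 0 = e" "\<And>t. t \<in> {0..1} \<Longrightarrow> p (?l t) = \<beta> t" by auto
  show "?l t = g t" if "t \<in> {0..1}" for t
    by (rule pathin_lift_unique[OF cov _ g(1) _ _ that]) (use l g in auto)
qed

text \<open>The lifts chosen separately for each \<open>w\<close> coincide with the continuous local
  lifts by uniqueness. Hence the global function is locally continuous, and no compatibility of
  local lifts has to be checked.\<close>

theorem continuous_map_path_lift:
  assumes cov: "covering_map E p Y"
    and F: "continuous_map (prod_topology (top_of_set {0..1}) W) Y F"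
    and f: "continuous_map W E f" and pf: "\<And>w. w \<in> topspace W \<Longrightarrow> p (f w) = F (0, w)"
  shows "continuous_map (prod_topology (top_of_set {0..1}) W) E (\<lambda>(t, w). path_lift E p (f w) (\<lambda>t. F (t, w)) t)"
    and "\<And>w. w \<in> topspace W \<Longrightarrow> pathin E (path_lift E p (f w) (\<lambda>t. F (t, w)))"
    and "\<And>w. w \<in> topspace W \<Longrightarrow> path_lift E p (f w) (\<lambda>t. F (t, w)) 0 = f w"
    and "\<And>w t. \<lbrakk>w \<in> topspace W; t \<in> {0..1}\<rbrakk> \<Longrightarrow> p (path_lift E p (f w) (\<lambda>t. F (t, w)) t) = F (t, w)"
proof -
  let ?l = "\<lambda>w. path_lift E p (f w) (\<lambda>t. F (t, w))"
  have *: "\<exists>N. openin W N \<and> w0 \<in> N \<and>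
      continuous_map (prod_topology (top_of_set {0..1}) (subtopology W N)) E (\<lambda>(t, w). ?l w t) \<and>
      (\<forall>w\<in>N. pathin E (?l w) \<and> ?l w 0 = f w \<and> (\<forall>t\<in>{0..1}. p (?l w t) = F (t, w)))"
    if w0: "w0 \<in> topspace W" for w0
  proof -
    obtain N G where N: "openin W N" "w0 \<in> N"
      and G: "continuous_map (prod_topology (top_of_set {0..1}) (subtopology W N)) E G"
      and G0: "\<And>w. w \<in> N \<Longrightarrow> G (0, w) = f w"
      and pG: "\<And>t w. \<lbrakk>t \<in> {0..1}; w \<in> N\<rbrakk> \<Longrightarrow> p (G (t, w)) = F (t, w)"
      using covering_map_local_homotopy_lift[OF cov F f pf w0] by blast
    have Gw: "pathin E (\<lambda>t. G (t, w))" if "w \<in> N" for w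
    proof -
      have "w \<in> topspace W" using that N openin_subset by blast
      then have "continuous_map (top_of_set {0..1}) (prod_topology (top_of_set {0..1}) (subtopology W N)) (\<lambda>t. (t, w))"
        using that by (intro continuous_map_pairedI) auto
      from continuous_map_compose[OF this G] show ?thesis by (simp add: pathin_def o_def)
    qed
    note l = path_lift_unique[OF cov Gw G0 pG]
    have "continuous_map (prod_topology (top_of_set {0..1}) (subtopology W N)) E (\<lambda>(t, w). ?l w t)"
      by (rule continuous_map_eq[OF G]) (auto intro!: l(4)[symmetric])
    then show ?thesis using N l by blast
  qed
  show "continuous_map (prod_topology (top_of_set {0..1}) W) E (\<lambda>(t, w). ?l w t)"
  proof (rule continuous_map_locally)
    fix x assume "x \<in> topspace (prod_topology (top_of_set {0..1::real}) W)"
    then have x: "fst x \<in> {0..1}" "snd x \<in> topspace W" by auto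
    obtain N where N: "openin W N" "snd x \<in> N"
      "continuous_map (prod_topology (top_of_set {0..1}) (subtopology W N)) E (\<lambda>(t, w). ?l w t)"
      using *[OF x(2)] by blast
    show "\<exists>U. openin (prod_topology (top_of_set {0..1}) W) U \<and> x \<in> U \<and>
        continuous_map (subtopology (prod_topology (top_of_set {0..1}) W) U) E (\<lambda>(t, w). ?l w t)"
    proof (intro exI conjI)
      show "openin (prod_topology (top_of_set {0..1}) W) ({0..1} \<times> N)"
        using N by (simp add: openin_prod_Times_iff)
      show "continuous_map (subtopology (prod_topology (top_of_set {0..1}) W) ({0..1} \<times> N)) E (\<lambda>(t, w). ?l w t)"
        using N(3) by (simp add: subtopology_Times subtopology_subtopology)
      show "x \<in> {0..1} \<times> N" using x N by (cases x) simp
    qed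
  qed
  show "pathin E (?l w)" "?l w 0 = f w" if "w \<in> topspace W" for w
    using *[OF that] by blast+
  show "p (?l w t) = F (t, w)" if "w \<in> topspace W" "t \<in> {0..1}" for w t
    using *[OF that(1)] that(2) by blast
qed

corollary path_lift:
  assumes cov: "covering_map E p Y" and \<beta>: "pathin Y \<beta>" and e: "e \<in> topspace E" "p e = \<beta> 0"
  shows "pathin E (path_lift E p e \<beta>)" "path_lift E p e \<beta> 0 = e"
    "\<And>t. t \<in> {0..1} \<Longrightarrow> p (path_lift E p e \<beta> t) = \<beta> t"
proof -
  \<comment> \<open>A single path is a homotopy parametrized by a one-point space.\<close>
  let ?W = "discrete_topology {()}"
  have "continuous_map (prod_topology (top_of_set {0..1}) ?W) Y (\<beta> \<circ> fst)"
    using \<beta> by (intro continuous_map_compose[OF continuous_map_fst]) (simp add: pathin_def)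
  from continuous_map_path_lift[OF cov this, of "\<lambda>_. e"] e
  show "pathin E (path_lift E p e \<beta>)" "path_lift E p e \<beta> 0 = e"
    "\<And>t. t \<in> {0..1} \<Longrightarrow> p (path_lift E p e \<beta> t) = \<beta> t" by (auto simp: o_def)
qed

text \<open>Lifting the whole homotopy from the constant starting point \<open>e\<close> makes the
  endpoints of the lifts a path above the constant \<open>\<beta> 1\<close>. By unique lifting that
  path is constant.\<close>

lemma path_lift_monodromy:
  assumes cov: "covering_map E p Y" and hom: "path_homotopic Y \<beta> \<beta>'"
    and e: "e \<in> topspace E" "p e = \<beta> 0"
  shows "path_lift E p e \<beta> 1 = path_lift E p e \<beta>' 1"
proof -
  let ?I = "top_of_set {0..1::real}"
  obtain h where h: "continuous_map (prod_topology ?I ?I) Y h"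
    and h0: "\<And>t. h (0, t) = \<beta> t" and h1: "\<And>t. h (1, t) = \<beta>' t"
    and hs: "\<And>s. s \<in> {0..1} \<Longrightarrow> h (s, 0) = \<beta> 0 \<and> h (s, 1) = \<beta> 1"
    using hom unfolding path_homotopic_def homotopic_with_def by auto
  \<comment> \<open>A homotopy has its deformation parameter first, but lifting takes place along
    the first coordinate, which must be the path parameter.\<close>
  have F: "continuous_map (prod_topology ?I ?I) Y (h \<circ> prod.swap)"
    by (rule continuous_map_compose[OF _ h])
       (auto simp: prod.swap_def intro!: continuous_intros)
  define g where "g s = path_lift E p e (\<lambda>t. h (s, t))" for s
  have f: "continuous_map ?I E (\<lambda>_. e)" using e by simp
  have g: "continuous_map (prod_topology ?I ?I) E (\<lambda>(t, s). g s t)"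
    and pg: "\<And>s t. \<lbrakk>s \<in> {0..1}; t \<in> {0..1}\<rbrakk> \<Longrightarrow> p (g s t) = h (s, t)"
    using continuous_map_path_lift[OF cov F f] e hs unfolding g_def by (auto simp: o_def)
  have "continuous_map ?I (prod_topology ?I ?I) (\<lambda>s. (1, s))"
    by (intro continuous_map_pairedI) auto
  from continuous_map_compose[OF this g] have g1: "pathin E (\<lambda>s. g s 1)"
    by (simp add: pathin_def o_def)
  then have "g 0 1 \<in> topspace E"
    unfolding pathin_def continuous_map_def by auto
  then have "pathin E (\<lambda>_. g 0 1)" by (simp add: pathin_const)
  have "g 1 1 = g 0 1"
    by (rule pathin_lift_unique[OF cov g1 \<open>pathin E (\<lambda>_. g 0 1)\<close>]) (use pg hs in auto)
  then show ?thesis by (simp add: g_def h0 h1)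
qed

section \<open>Straightening paths\<close>

text \<open>Evaluation is continuous for the compact-open topology because every point of the
  interval has arbitrarily small compact neighbourhoods.\<close>

lemma continuous_map_path_eval:
  "continuous_map (prod_topology (top_of_set {0..1}) (path_space Y)) Y (\<lambda>(t, \<gamma>). \<gamma> t)"
  (is "continuous_map (prod_topology ?I _) _ _")
  unfolding continuous_map_def
proof (intro conjI allI impI)
  have tP: "topspace (path_space Y) = continuous_maps ?I Y"
    by (simp add: path_space_def)
  show "(\<lambda>(t, \<gamma>). \<gamma> t) \<in> topspace (prod_topology ?I (path_space Y)) \<rightarrow> topspace Y"
    by (auto simp: tP continuous_maps_def continuous_map_def)
  fix U assume U: "openin Y U"
  show "openin (prod_topology ?I (path_space Y)) {x \<in> topspace (prod_topology ?I (path_space Y)). (\<lambda>(t, \<gamma>). \<gamma> t) x \<in> U}"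
    unfolding openin_prod_topology_alt
  proof (intro allI impI)
    fix t \<gamma> assume "(t, \<gamma>) \<in> {x \<in> topspace (prod_topology ?I (path_space Y)). (\<lambda>(t, \<gamma>). \<gamma> t) x \<in> U}"
    then have t: "t \<in> {0..1}" and \<gamma>: "\<gamma> \<in> continuous_maps ?I Y" and tU: "\<gamma> t \<in> U"
      by (auto simp: tP)
    have "openin ?I {s \<in> topspace ?I. \<gamma> s \<in> U}"
      using \<gamma> U by (intro openin_continuous_map_preimage) (auto simp: continuous_maps_def)
    moreover have "t \<in> {s \<in> topspace ?I. \<gamma> s \<in> U}" using t tU by simp
    ultimately obtain e where e: "e > 0" "ball t e \<inter> {0..1} \<subseteq> {s \<in> topspace ?I. \<gamma> s \<in> U}"
      unfolding openin_contains_ball by blast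
    \<comment> \<open>Half the radius gives a compact neighbourhood of \<open>t\<close> that
      \<open>\<gamma>\<close> still maps into \<open>U\<close>.\<close>
    let ?K = "cball t (e/2) \<inter> {0..1}"
    let ?N = "{\<delta> \<in> continuous_maps ?I Y. \<delta> ` ?K \<subseteq> U}"
    have "compact ?K" by (intro compact_Int_closed) auto
    then have "compactin ?I ?K"
      by (simp add: compactin_subtopology)
    then have "openin (path_space Y) ?N"
      unfolding path_space_def compact_open_topology_def
      by (intro topology_generated_by_Basis) (use U in blast)
    moreover have "openin ?I ({0..1} \<inter> ball t (e/2))"
      by (simp add: openin_open_Int)
    moreover have "\<gamma> \<in> ?N"
    proof -
      have "?K \<subseteq> ball t e \<inter> {0..1}" using e(1) by (auto simp: dist_real_def)
      then show ?thesis using e(2) \<gamma> by auto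
    qed
    ultimately show "\<exists>J N. openin ?I J \<and> openin (path_space Y) N \<and> t \<in> J \<and> \<gamma> \<in> N \<and>
        J \<times> N \<subseteq> {x \<in> topspace (prod_topology ?I (path_space Y)). (\<lambda>(t, \<gamma>). \<gamma> t) x \<in> U}"
      using t e(1) by (intro exI[of _ "{0..1} \<inter> ball t (e/2)"] exI[of _ ?N])
        (fastforce simp: tP)
  qed
qed

lemma path_homotopic_pathin:
  assumes "path_homotopic Y \<alpha> \<beta>"
  shows "pathin Y \<alpha>" "pathin Y \<beta>"
  using homotopic_with_imp_continuous_maps[OF assms[unfolded path_homotopic_def]]
  by (auto simp: pathin_def)

lemma path_homotopic_trans:
  assumes "path_homotopic Y \<alpha> \<beta>" and "path_homotopic Y \<beta> \<gamma>"
  shows "path_homotopic Y \<alpha> \<gamma>"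
  using homotopic_with_trans[OF assms(1)[unfolded path_homotopic_def]]
    assms(2)[unfolded path_homotopic_def path_homotopic_endpoints[OF assms(1)]]
  unfolding path_homotopic_def by blast

text \<open>A contraction \<open>K\<close> of \<open>E\<close> deforms a path \<open>g\<close>, rel endpoints, through the paths which run along
  \<open>K\<close> from \<open>g 0\<close> up to time \<open>s\<close>, then follow the image of \<open>g\<close> under \<open>K (s, _)\<close>, and finally run back
  along \<open>K\<close> to \<open>g 1\<close>. At \<open>s = 1\<close> only the endpoints of \<open>g\<close> matter.\<close>

definition straighten_path :: "(real \<times> 'b \<Rightarrow> 'b) \<Rightarrow> real \<Rightarrow> (real \<Rightarrow> 'b) \<Rightarrow> real \<Rightarrow> 'b"
  where "straighten_path K s g t =
    K (min s (min (3 * t) (3 * (1 - t))), g (max 0 (min 1 ((t - s/3) / (1 - 2 * s/3)))))"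

lemma straighten_path_0:
  assumes "\<And>e. e \<in> topspace E \<Longrightarrow> K (0, e) = e" and "pathin E g" and "t \<in> {0..1}"
  shows "straighten_path K 0 g t = g t"
proof -
  have "g t \<in> topspace E" using assms(2,3) by (auto simp: pathin_def continuous_map_def)
  then show ?thesis using assms(1,3) by (simp add: straighten_path_def min_absorb1)
qed

lemma straighten_path_endpoints:
  assumes "\<And>e. e \<in> topspace E \<Longrightarrow> K (0, e) = e" and "pathin E g" and s: "s \<in> {0..1}"
  shows "straighten_path K s g 0 = g 0" "straighten_path K s g 1 = g 1"
proof -
  have g: "g 0 \<in> topspace E" "g 1 \<in> topspace E"
    using assms(2) by (auto simp: pathin_def continuous_map_def)
  have "(0 - s/3) / (1 - 2 * s/3) \<le> 0" "1 \<le> (1 - s/3) / (1 - 2 * s/3)"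
    using s by (auto simp: divide_le_0_iff le_divide_eq)
  then have "max 0 (min 1 ((0 - s/3) / (1 - 2 * s/3))) = 0" "max 0 (min 1 ((1 - s/3) / (1 - 2 * s/3))) = 1"
    by auto
  moreover have "min s (min (3 * 0) (3 * (1 - 0))) = 0" "min s (min (3 * 1) (3 * (1 - 1))) = 0"
    using s by auto
  ultimately show "straighten_path K s g 0 = g 0" "straighten_path K s g 1 = g 1"
    using g assms(1) by (simp_all only: straighten_path_def)
qed

text \<open>On the middle third \<open>K (1, _)\<close> collapses everything to \<open>e0\<close>.
  On the outer thirds the argument of the path is clamped to 0 or 1, so only the common endpoints
  enter.\<close>

lemma straighten_path_1:
  assumes K: "\<And>e. e \<in> topspace E \<Longrightarrow> K (1, e) = e0" and "pathin E g" "pathin E h"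
    and eq: "g 0 = h 0" "g 1 = h 1" and t: "t \<in> {0..1}"
  shows "straighten_path K 1 g t = straighten_path K 1 h t"
proof -
  have in_E: "g r \<in> topspace E" "h r \<in> topspace E" if "r \<in> {0..1}" for r
    using assms(2,3) that by (auto simp: pathin_def continuous_map_def)
  consider "t \<le> 1/3" | "1/3 < t" "t < 2/3" | "2/3 \<le> t" by linarith
  then show ?thesis
  proof cases
    case 1
    then have "max 0 (min 1 ((t - 1/3) / (1 - 2 * 1/3))) = 0" by (simp add: max_def min_def field_simps)
    then show ?thesis by (simp add: straighten_path_def eq)
  next
    case 2
    then have "min 1 (min (3 * t) (3 * (1 - t))) = 1" by (simp add: min_def)
    moreover have "max 0 (min 1 r) \<in> {0..1}" for r :: real by auto
    ultimately show ?thesis using K in_E by (simp only: straighten_path_def)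
  next
    case 3
    then have "max 0 (min 1 ((t - 1/3) / (1 - 2 * 1/3))) = 1" using t by (simp add: max_def min_def field_simps)
    then show ?thesis by (simp add: straighten_path_def eq)
  qed
qed

text \<open>The deformation time \<open>s\<close> may vary with the parameter \<open>w\<close>: it
  is later taken to be a bump function of the starting point.\<close>

lemma continuous_map_straighten_path:
  assumes K: "continuous_map (prod_topology (top_of_set {0..1}) E) E K"
    and g: "continuous_map (prod_topology (top_of_set {0..1}) W) E (\<lambda>(t, w). g w t)"
    and s: "continuous_map W euclideanreal s" "\<And>w. w \<in> topspace W \<Longrightarrow> s w \<in> {0..1}"
  shows "continuous_map (prod_topology (top_of_set {0..1}) W) E (\<lambda>(t, w). straighten_path K (s w) (g w) t)"
proof -
  let ?I = "top_of_set {0..1::real}"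
  let ?P = "prod_topology ?I W"
  have ft: "continuous_map ?P euclideanreal fst"
    using continuous_map_fst[of ?I W] by (rule continuous_map_into_fulltopology)
  have sw: "continuous_map ?P euclideanreal (\<lambda>x. s (snd x))"
    using continuous_map_compose[OF continuous_map_snd s(1)] by (simp add: o_def)
  have a: "continuous_map ?P ?I (\<lambda>x. min (s (snd x)) (min (3 * fst x) (3 * (1 - fst x))))"
  proof (rule continuous_map_into_subtopology)
    show "continuous_map ?P euclideanreal (\<lambda>x. min (s (snd x)) (min (3 * fst x) (3 * (1 - fst x))))"
      by (intro continuous_map_real_min continuous_map_real_mult_left continuous_map_diff ft sw) auto
    show "(\<lambda>x. min (s (snd x)) (min (3 * fst x) (3 * (1 - fst x)))) \<in> topspace ?P \<rightarrow> {0..1}"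
      using s(2) by (auto simp: min_le_iff_disj)
  qed
  \<comment> \<open>For \<open>s\<close> in \<open>{0..1}\<close> the denominator is at least
    1/3.\<close>
  have nz: "1 - 2 * s (snd x)/3 \<noteq> 0" if "x \<in> topspace ?P" for x
    using s(2)[of "snd x"] that by auto
  have "continuous_map ?P euclideanreal (\<lambda>x. max 0 (min 1 ((fst x - s (snd x)/3) / (1 - 2 * s (snd x)/3))))"
    using nz by (intro continuous_map_real_max continuous_map_real_min continuous_map_real_divide
        continuous_map_diff continuous_map_real_mult_left ft sw) auto
  then have "continuous_map ?P ?I (\<lambda>x. max 0 (min 1 ((fst x - s (snd x)/3) / (1 - 2 * s (snd x)/3))))"
    by (rule continuous_map_into_subtopology) auto
  then have "continuous_map ?P ?P (\<lambda>x. (max 0 (min 1 ((fst x - s (snd x)/3) / (1 - 2 * s (snd x)/3))), snd x))"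
    by (intro continuous_map_pairedI continuous_map_snd)
  from continuous_map_compose[OF this g]
  have "continuous_map ?P E (\<lambda>x. g (snd x) (max 0 (min 1 ((fst x - s (snd x)/3) / (1 - 2 * s (snd x)/3)))))"
    by (simp add: o_def)
  with a have "continuous_map ?P (prod_topology ?I E) (\<lambda>x. (min (s (snd x)) (min (3 * fst x) (3 * (1 - fst x))),
      g (snd x) (max 0 (min 1 ((fst x - s (snd x)/3) / (1 - 2 * s (snd x)/3))))))"
    by (rule continuous_map_pairedI)
  from continuous_map_compose[OF this K] show ?thesis
    by (simp add: o_def straighten_path_def case_prod_unfold)
qed

lemma path_homotopic_straighten_path:
  assumes K: "continuous_map (prod_topology (top_of_set {0..1}) E) E K"
    and K0: "\<And>e. e \<in> topspace E \<Longrightarrow> K (0, e) = e"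
    and g: "pathin E g" and s: "s \<in> {0..1}"
  shows "path_homotopic E g (straighten_path K s g)"
proof -
  let ?I = "top_of_set {0..1::real}"
  have g': "continuous_map (prod_topology ?I ?I) E (\<lambda>(t, r). g t)"
    using continuous_map_compose[OF continuous_map_fst g[unfolded pathin_def]]
    unfolding o_def case_prod_unfold .
  \<comment> \<open>The homotopy parameter \<open>r\<close> scales the deformation time from 0 up to
    \<open>s\<close>.\<close>
  have "continuous_map (prod_topology ?I ?I) E (\<lambda>(t, r). straighten_path K (r * s) g t)"
    using s by (intro continuous_map_straighten_path[OF K g'])
      (auto simp: mult_le_one intro!: continuous_intros)
  moreover have "continuous_map (prod_topology ?I ?I) (prod_topology ?I ?I) prod.swap"
    by (auto simp: prod.swap_def intro!: continuous_intros)
  ultimately have c: "continuous_map (prod_topology ?I ?I) E ((\<lambda>(t, r). straighten_path K (r * s) g t) \<circ> prod.swap)"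
    by (rule continuous_map_compose[rotated])
  have rs: "r * s \<in> {0..1}" if "r \<in> {0..1}" for r
    using s that by (auto simp: mult_le_one)
  have "path_homotopic E (straighten_path K 0 g) (straighten_path K s g)"
    unfolding path_homotopic_def homotopic_with_def
    by (intro exI conjI, rule c)
      (use straighten_path_endpoints[OF K0 g] rs in auto)
  then show ?thesis
    by (rule path_homotopic_cong) (use straighten_path_0[OF K0 g] in auto)
qed

section \<open>Gluing the local choices of paths\<close>

locale straightening =
  fixes E :: "'b topology" and p :: "'b \<Rightarrow> 'a" and Y :: "'a topology"
    and K :: "real \<times> 'b \<Rightarrow> 'b" and e0 :: 'b
    and U :: "nat \<Rightarrow> 'a set" and \<sigma> :: "nat \<Rightarrow> 'a \<Rightarrow> 'b"
    and \<tau> :: "nat \<Rightarrow> 'a \<Rightarrow> real" and S :: "nat \<Rightarrow> 'a set"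
  assumes cov: "covering_map E p Y"
    and K: "continuous_map (prod_topology (top_of_set {0..1}) E) E K"
    and K0: "\<And>e. e \<in> topspace E \<Longrightarrow> K (0, e) = e"
    and K1: "\<And>e. e \<in> topspace E \<Longrightarrow> K (1, e) = e0"
    and U: "\<And>n. openin Y (U n)"
    and \<sigma>: "\<And>n. continuous_map (subtopology Y (U n)) E (\<sigma> n)"
    and p\<sigma>: "\<And>n y. y \<in> U n \<Longrightarrow> p (\<sigma> n y) = y"
    and \<tau>: "\<And>n. continuous_map Y euclideanreal (\<tau> n)"
    and \<tau>01: "\<And>n y. \<tau> n y \<in> {0..1}"
    and S: "\<And>n. closedin Y (S n)" "\<And>n. S n \<subseteq> U n"
    and \<tau>S: "\<And>n y. y \<in> topspace Y - S n \<Longrightarrow> \<tau> n y = 0"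
    and \<tau>_one: "\<And>y. y \<in> topspace Y \<Longrightarrow> \<exists>N n. openin Y N \<and> y \<in> N \<and> (\<forall>x\<in>N. \<tau> n x = 1)"
    and \<tau>_zero: "\<And>y. y \<in> topspace Y \<Longrightarrow> \<exists>N m. openin Y N \<and> y \<in> N \<and> (\<forall>n\<ge>m. \<forall>x\<in>N. \<tau> n x = 0)"
begin

text \<open>Each \<open>straighten n c\<close> is a path in the class \<open>c\<close>, starting from an arbitrary representative.
  Where \<open>\<tau> n = 1\<close>, step \<open>n\<close> makes the choice depend continuously on \<open>c\<close>, and later steps preserve
  continuity; near any point only finitely many steps do anything.\<close>

primrec straighten :: "nat \<Rightarrow> (real \<Rightarrow> 'a) set \<Rightarrow> real \<Rightarrow> 'a"
  where "straighten 0 c = (SOME \<beta>. \<beta> \<in> c)"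
  | "straighten (Suc n) c =
      (if diag_P0 c \<in> U n
       then \<lambda>t. p (straighten_path K (\<tau> n (diag_P0 c)) (path_lift E p (\<sigma> n (diag_P0 c)) (straighten n c)) t)
       else straighten n c)"

lemma \<sigma>_in: "y \<in> U n \<Longrightarrow> \<sigma> n y \<in> topspace E"
  using \<sigma>[of n] openin_subset[OF U[of n]] by (auto simp: continuous_map_def)

lemma p_continuous: "continuous_map E Y p"
  using cov by (simp add: covering_map_def)

lemma lift_\<sigma>:
  assumes "pathin Y \<beta>" "\<beta> 0 \<in> U n"
  shows "pathin E (path_lift E p (\<sigma> n (\<beta> 0)) \<beta>)" "path_lift E p (\<sigma> n (\<beta> 0)) \<beta> 0 = \<sigma> n (\<beta> 0)"
    "\<And>t. t \<in> {0..1} \<Longrightarrow> p (path_lift E p (\<sigma> n (\<beta> 0)) \<beta> t) = \<beta> t"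
  using path_lift[OF cov assms(1) \<sigma>_in[OF assms(2)] p\<sigma>[OF assms(2)]] by auto

text \<open>A step deforms a lift rel endpoints and projects the result, so the class never changes.
  In particular every stage starts at \<open>\<gamma> 0\<close>, so the next lift can start at
  \<open>\<sigma> n (\<gamma> 0)\<close>.\<close>

lemma straighten_homotopic:
  assumes \<gamma>: "\<gamma> \<in> topspace (path_space Y)"
  shows "path_homotopic Y \<gamma> (straighten n (path_class Y \<gamma>))"
proof (induction n)
  case 0
  have "(SOME \<beta>. \<beta> \<in> path_class Y \<gamma>) \<in> path_class Y \<gamma>"
    using path_class_self[OF \<gamma>] by (auto simp: some_in_eq)
  then show ?case by (simp add: path_class_def)
next
  case (Suc n)
  let ?\<beta> = "straighten n (path_class Y \<gamma>)"
  have \<beta>: "pathin Y ?\<beta>" "?\<beta> 0 = \<gamma> 0"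
    using path_homotopic_pathin[OF Suc] path_homotopic_endpoints[OF Suc] by auto
  show ?case
  proof (cases "\<gamma> 0 \<in> U n")
    case True
    let ?l = "path_lift E p (\<sigma> n (\<gamma> 0)) ?\<beta>"
    have l: "pathin E ?l" "\<And>t. t \<in> {0..1} \<Longrightarrow> p (?l t) = ?\<beta> t"
      using lift_\<sigma>[OF \<beta>(1), of n] True \<beta>(2) by auto
    have "path_homotopic Y (p \<circ> ?l) (p \<circ> straighten_path K (\<tau> n (\<gamma> 0)) ?l)"
      by (rule path_homotopic_compose[OF path_homotopic_straighten_path[OF K K0 l(1) \<tau>01] p_continuous])
    then have "path_homotopic Y ?\<beta> (p \<circ> straighten_path K (\<tau> n (\<gamma> 0)) ?l)"
      by (rule path_homotopic_cong) (use l(2) in auto)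
    then show ?thesis
      using path_homotopic_trans[OF Suc] True by (simp add: diag_P_path_class[OF \<gamma>] o_def)
  qed (use Suc in \<open>simp add: diag_P_path_class[OF \<gamma>]\<close>)
qed

text \<open>At deformation time 0 the lift is unchanged and projects back to the previous path. The
  equality is confined to \<open>{0..1}\<close>, where the lift is controlled.\<close>

lemma straighten_eq:
  assumes \<gamma>: "\<gamma> \<in> topspace (path_space Y)" and "\<tau> n (\<gamma> 0) = 0" and t: "t \<in> {0..1}"
  shows "straighten (Suc n) (path_class Y \<gamma>) t = straighten n (path_class Y \<gamma>) t"
proof (cases "\<gamma> 0 \<in> U n")
  case True
  have "pathin Y (straighten n (path_class Y \<gamma>))" "straighten n (path_class Y \<gamma>) 0 = \<gamma> 0"
    using path_homotopic_pathin[OF straighten_homotopic[OF \<gamma>]]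
      path_homotopic_endpoints[OF straighten_homotopic[OF \<gamma>]] by auto
  then show ?thesis
    using lift_\<sigma>[of "straighten n (path_class Y \<gamma>)" n] True assms(2) t
    by (simp add: diag_P_path_class[OF \<gamma>] straighten_path_0[where E = E, OF K0])
qed (simp add: diag_P_path_class[OF \<gamma>])

lemma straighten_eq_later:
  assumes \<gamma>: "\<gamma> \<in> topspace (path_space Y)" and "\<And>n. n \<ge> m \<Longrightarrow> \<tau> n (\<gamma> 0) = 0"
    and t: "t \<in> {0..1}" and "m \<le> n"
  shows "straighten n (path_class Y \<gamma>) t = straighten m (path_class Y \<gamma>) t"
  using \<open>m \<le> n\<close>
proof (induction rule: dec_induct)
  case (step k)
  then show ?case using straighten_eq[OF \<gamma> assms(2) t, of k] by simp
qed simp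

abbreviation paths_from :: "'a set \<Rightarrow> (real \<Rightarrow> 'a) topology"
  where "paths_from N \<equiv> subtopology (path_space Y) {\<gamma>. \<gamma> 0 \<in> N}"

lemma path_start_continuous: "continuous_map (path_space Y) Y (\<lambda>\<gamma>. \<gamma> 0)"
proof -
  have "continuous_map (path_space Y) (prod_topology (top_of_set {0..1::real}) (path_space Y)) (\<lambda>\<gamma>. (0, \<gamma>))"
    by (intro continuous_map_pairedI) auto
  from continuous_map_compose[OF this continuous_map_path_eval] show ?thesis by (simp add: o_def)
qed

lemma openin_paths_from: "openin Y N \<Longrightarrow> openin (path_space Y) {\<gamma> \<in> topspace (path_space Y). \<gamma> 0 \<in> N}"
  using openin_continuous_map_preimage[OF path_start_continuous] .

text \<open>The starting point depends continuously on the path, so continuity may be tested locally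
  in the starting point alone.\<close>

lemma continuous_map_paths_from_locally:
  assumes "\<And>\<gamma>. \<gamma> \<in> topspace (paths_from N) \<Longrightarrow> \<exists>M. openin Y M \<and> \<gamma> 0 \<in> M \<and>
    continuous_map (prod_topology (top_of_set {0..1::real}) (paths_from (N \<inter> M))) Z f"
  shows "continuous_map (prod_topology (top_of_set {0..1::real}) (paths_from N)) Z f"
proof (rule continuous_map_locally)
  let ?X = "prod_topology (top_of_set {0..1::real}) (paths_from N)"
  fix x assume "x \<in> topspace ?X"
  then have x: "fst x \<in> {0..1}" "snd x \<in> topspace (paths_from N)" by auto
  obtain M where M: "openin Y M" "snd x 0 \<in> M"
    and f: "continuous_map (prod_topology (top_of_set {0..1::real}) (paths_from (N \<inter> M))) Z f"
    using assms[OF x(2)] by blast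
  let ?V = "{\<gamma> \<in> topspace (path_space Y). \<gamma> 0 \<in> M} \<inter> topspace (paths_from N)"
  have V: "openin (paths_from N) ?V"
    unfolding openin_subtopology using openin_paths_from[OF M(1)] by (intro exI[of _ "{\<gamma> \<in> topspace (path_space Y). \<gamma> 0 \<in> M}"]) auto
  have "subtopology (paths_from N) ?V =
      subtopology (path_space Y) (topspace (path_space Y) \<inter> {\<gamma>. \<gamma> 0 \<in> N \<inter> M})"
    unfolding subtopology_subtopology by (rule arg_cong[of _ _ "subtopology (path_space Y)"]) auto
  then have eq: "subtopology (paths_from N) ?V = paths_from (N \<inter> M)"
    by (simp only: subtopology_restrict)
  show "\<exists>W. openin ?X W \<and> x \<in> W \<and> continuous_map (subtopology ?X W) Z f"
  proof (intro exI conjI)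
    show "openin ?X ({0..1} \<times> ?V)"
      using V by (simp add: openin_prod_Times_iff)
    show "x \<in> {0..1} \<times> ?V" using x M(2) by (cases x) simp
    have "subtopology ?X ({0..1} \<times> ?V) = prod_topology (top_of_set {0..1::real}) (paths_from (N \<inter> M))"
      unfolding subtopology_Times eq by (simp add: subtopology_subtopology)
    then show "continuous_map (subtopology ?X ({0..1} \<times> ?V)) Z f"
      using f by simp
  qed
qed

text \<open>One step of the construction, applied to any continuous family of paths with the right
  starting points. It serves for \<open>\<gamma>\<close> itself at the step that erases the
  arbitrary choice, and for the chosen paths at later steps.\<close>

lemma continuous_map_straighten_lift:
  assumes N: "N \<subseteq> U n"
    and \<beta>: "continuous_map (prod_topology (top_of_set {0..1}) (paths_from N)) Y (\<lambda>(t, \<gamma>). \<beta> \<gamma> t)"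
    and \<beta>0: "\<And>\<gamma>. \<gamma> \<in> topspace (paths_from N) \<Longrightarrow> \<beta> \<gamma> 0 = \<gamma> 0"
  shows "continuous_map (prod_topology (top_of_set {0..1}) (paths_from N)) Y
    (\<lambda>(t, \<gamma>). p (straighten_path K (\<tau> n (\<gamma> 0)) (path_lift E p (\<sigma> n (\<gamma> 0)) (\<beta> \<gamma>)) t))"
proof -
  have start: "continuous_map (paths_from N) Y (\<lambda>\<gamma>. \<gamma> 0)"
    by (rule continuous_map_from_subtopology[OF path_start_continuous])
  then have "continuous_map (paths_from N) (subtopology Y (U n)) (\<lambda>\<gamma>. \<gamma> 0)"
    by (rule continuous_map_into_subtopology) (use N in auto)
  from continuous_map_compose[OF this \<sigma>] have f: "continuous_map (paths_from N) E (\<lambda>\<gamma>. \<sigma> n (\<gamma> 0))"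
    by (simp add: o_def)
  have s: "continuous_map (paths_from N) euclideanreal (\<lambda>\<gamma>. \<tau> n (\<gamma> 0))"
    using continuous_map_compose[OF start \<tau>] by (simp add: o_def)
  have p0: "p (\<sigma> n (\<gamma> 0)) = (\<lambda>(t, \<gamma>). \<beta> \<gamma> t) (0, \<gamma>)" if "\<gamma> \<in> topspace (paths_from N)" for \<gamma>
  proof -
    have "\<gamma> 0 \<in> U n" using that N by auto
    then show ?thesis using \<beta>0[OF that] p\<sigma> by simp
  qed
  have "continuous_map (prod_topology (top_of_set {0..1}) (paths_from N)) E
      (\<lambda>(t, \<gamma>). path_lift E p (\<sigma> n (\<gamma> 0)) (\<beta> \<gamma>) t)"
    using continuous_map_path_lift(1)[OF cov \<beta> f p0] by simp
  from continuous_map_compose[OF continuous_map_straighten_path[OF K this s \<tau>01] p_continuous]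
  show ?thesis by (simp add: o_def case_prod_unfold)
qed

text \<open>Step \<open>k\<close> runs to deformation time 1 over \<open>N\<close>, so its result
  depends only on the endpoints of the lift and not on the representative. Later steps preserve the
  continuity gained there.\<close>

lemma straighten_continuous:
  assumes "openin Y N" "\<And>x. x \<in> N \<Longrightarrow> \<tau> k x = 1" "k < n"
  shows "continuous_map (prod_topology (top_of_set {0..1}) (paths_from N)) Y
    (\<lambda>(t, \<gamma>). straighten n (path_class Y \<gamma>) t)"
  using \<open>k < n\<close>
proof (induction n)
  \<comment> \<open>Vacuous because of \<open>k < n\<close>; the induction really begins with the
    case \<open>k = n\<close> below.\<close>
  case 0
  then show ?case by simp
next
  case (Suc n)
  have endp: "straighten n (path_class Y \<gamma>) 0 = \<gamma> 0" if "\<gamma> \<in> topspace (path_space Y)" for \<gamma>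
    using path_homotopic_endpoints[OF straighten_homotopic[OF that]] by simp
  show ?case
  proof (cases "k = n")
    case True
    have "N \<subseteq> S n"
    proof
      fix x assume "x \<in> N"
      then have "x \<in> topspace Y" "\<tau> n x \<noteq> 0"
        using openin_subset[OF assms(1)] assms(2) True by auto
      then show "x \<in> S n" using \<tau>S by blast
    qed
    then have N: "N \<subseteq> U n" using S by blast
    \<comment> \<open>Straightening each \<open>\<gamma>\<close> itself is visibly continuous; it
      remains to see that this gives the same path as straightening the chosen
      representative.\<close>
    have "continuous_map (prod_topology (top_of_set {0..1}) (paths_from N)) Y (\<lambda>(t, \<gamma>). \<gamma> t)"
      using continuous_map_from_subtopology[OF continuous_map_path_eval[of Y], of "UNIV \<times> {\<gamma>. \<gamma> 0 \<in> N}"]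
      by (simp add: subtopology_Times)
    from continuous_map_straighten_lift[OF N this]
    show ?thesis
    proof (rule continuous_map_eq)
      fix x assume "x \<in> topspace (prod_topology (top_of_set {0..1::real}) (paths_from N))"
      then obtain t \<gamma> where x: "x = (t, \<gamma>)" "t \<in> {0..1}" and \<gamma>: "\<gamma> \<in> topspace (path_space Y)" "\<gamma> 0 \<in> N"
        by (cases x) auto
      have \<gamma>U: "\<gamma> 0 \<in> U n" using \<gamma> N by blast
      note hom = straighten_homotopic[OF \<gamma>(1), of n]
      let ?\<beta> = "straighten n (path_class Y \<gamma>)"
      have \<beta>: "pathin Y \<gamma>" "pathin Y ?\<beta>" using path_homotopic_pathin[OF hom] by auto
      \<comment> \<open>Homotopic paths have lifts with equal endpoints, which is all that the
        straightened lifts at time 1 depend on.\<close>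
      have "path_lift E p (\<sigma> n (\<gamma> 0)) \<gamma> 1 = path_lift E p (\<sigma> n (\<gamma> 0)) ?\<beta> 1"
        by (rule path_lift_monodromy[OF cov hom \<sigma>_in[OF \<gamma>U] p\<sigma>[OF \<gamma>U]])
      then have "straighten_path K 1 (path_lift E p (\<sigma> n (\<gamma> 0)) \<gamma>) t = straighten_path K 1 (path_lift E p (\<sigma> n (\<gamma> 0)) ?\<beta>) t"
        using lift_\<sigma>(1,2)[OF \<beta>(1) \<gamma>U] lift_\<sigma>(1,2)[OF \<beta>(2), of n] \<gamma>U endp[OF \<gamma>(1)]
        by (intro straighten_path_1[where K = K and E = E, OF K1 _ _ _ _ x(2)]) auto
      then show "(\<lambda>(t, \<gamma>). p (straighten_path K (\<tau> n (\<gamma> 0)) (path_lift E p (\<sigma> n (\<gamma> 0)) \<gamma>) t)) x =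
          (\<lambda>(t, \<gamma>). straighten (Suc n) (path_class Y \<gamma>) t) x"
        using \<gamma> \<gamma>U assms(2) by (simp add: x diag_P_path_class True)
    qed simp
  next
    case False
    then have IH: "continuous_map (prod_topology (top_of_set {0..1}) (paths_from N)) Y
        (\<lambda>(t, \<gamma>). straighten n (path_class Y \<gamma>) t)"
      using Suc by simp
    have IH': "continuous_map (prod_topology (top_of_set {0..1}) (paths_from (N \<inter> M))) Y
        (\<lambda>(t, \<gamma>). straighten n (path_class Y \<gamma>) t)" for M
    proof -
      have "subtopology (prod_topology (top_of_set {0..1}) (paths_from N)) (UNIV \<times> {\<gamma>. \<gamma> 0 \<in> M}) =
          prod_topology (top_of_set {0..1::real}) (paths_from (N \<inter> M))"
        by (simp add: subtopology_Times subtopology_subtopology Int_def)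
      then show ?thesis
        using continuous_map_from_subtopology[OF IH, of "UNIV \<times> {\<gamma>. \<gamma> 0 \<in> M}"] by (simp only:)
    qed
    show ?thesis
    proof (rule continuous_map_paths_from_locally)
      fix \<gamma> assume "\<gamma> \<in> topspace (paths_from N)"
      then have "\<gamma> 0 \<in> N" by simp
      show "\<exists>M. openin Y M \<and> \<gamma> 0 \<in> M \<and> continuous_map (prod_topology (top_of_set {0..1}) (paths_from (N \<inter> M))) Y
          (\<lambda>(t, \<gamma>). straighten (Suc n) (path_class Y \<gamma>) t)"
      \<comment> \<open>The open sets \<open>U n\<close> and \<open>topspace Y - S n\<close> cover
        \<open>Y\<close>: over the first the step is given by the lifting formula, over the second
        it changes nothing. This hides the case distinction in \<open>straighten\<close>.\<close>
      proof (cases "\<gamma> 0 \<in> U n")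
        case True
        have "continuous_map (prod_topology (top_of_set {0..1}) (paths_from (N \<inter> U n))) Y
            (\<lambda>(t, \<gamma>). straighten (Suc n) (path_class Y \<gamma>) t)"
        proof (rule continuous_map_eq[OF continuous_map_straighten_lift[OF _ IH', of "U n" n]])
          fix x assume "x \<in> topspace (prod_topology (top_of_set {0..1::real}) (paths_from (N \<inter> U n)))"
          then obtain t \<gamma> where "x = (t, \<gamma>)" "\<gamma> \<in> topspace (path_space Y)" "\<gamma> 0 \<in> U n"
            by (cases x) auto
          then show "(\<lambda>(t, \<gamma>). p (straighten_path K (\<tau> n (\<gamma> 0))
                (path_lift E p (\<sigma> n (\<gamma> 0)) (straighten n (path_class Y \<gamma>))) t)) x =
              (\<lambda>(t, \<gamma>). straighten (Suc n) (path_class Y \<gamma>) t) x"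
            by (simp add: diag_P_path_class)
        qed (simp_all add: endp)
        then show ?thesis using True U by blast
      next
        case False
        have "openin Y (topspace Y - S n)" using S by blast
        moreover have "\<gamma> 0 \<in> topspace Y - S n"
          using False S \<open>\<gamma> 0 \<in> N\<close> openin_subset[OF assms(1)] by blast
        moreover have "continuous_map (prod_topology (top_of_set {0..1}) (paths_from (N \<inter> (topspace Y - S n)))) Y
            (\<lambda>(t, \<gamma>). straighten (Suc n) (path_class Y \<gamma>) t)"
        proof (rule continuous_map_eq[OF IH'])
          fix x assume "x \<in> topspace (prod_topology (top_of_set {0..1::real}) (paths_from (N \<inter> (topspace Y - S n))))"
          then obtain t \<gamma> where "x = (t, \<gamma>)" "t \<in> {0..1}" "\<gamma> \<in> topspace (path_space Y)" "\<gamma> 0 \<in> topspace Y - S n"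
            by (cases x) auto
          then show "(\<lambda>(t, \<gamma>). straighten n (path_class Y \<gamma>) t) x =
              (\<lambda>(t, \<gamma>). straighten (Suc n) (path_class Y \<gamma>) t) x"
            using straighten_eq[of \<gamma> n t] \<tau>S by (simp del: straighten.simps)
        qed
        ultimately show ?thesis by blast
      qed
    qed
  qed
qed

lemma homotopic_diag_P0_P1: "homotopic_with (\<lambda>_. True) (diagonal_cover Y) Y diag_P0 diag_P1"
proof -
  let ?I = "top_of_set {0..1::real}"
  \<comment> \<open>From stage \<open>m c\<close> on, the chosen path of \<open>c\<close> no longer
    changes, so \<open>h\<close> follows the final choice.\<close>
  define m where "m c = (LEAST m. \<forall>n\<ge>m. \<tau> n (diag_P0 c) = 0)" for c
  define h where "h = (\<lambda>(t, c). straighten (m c) c t)"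
  have h_eq: "h (t, path_class Y \<gamma>) = straighten n (path_class Y \<gamma>) t"
    if \<gamma>: "\<gamma> \<in> topspace (path_space Y)" and zero: "\<And>n. n \<ge> k \<Longrightarrow> \<tau> n (\<gamma> 0) = 0"
      and "k \<le> n" and t: "t \<in> {0..1}" for t \<gamma> k n
  proof -
    let ?c = "path_class Y \<gamma>"
    have "\<forall>n\<ge>m ?c. \<tau> n (diag_P0 ?c) = 0" "m ?c \<le> k"
      unfolding m_def by (rule LeastI[of _ k], use zero in \<open>simp add: diag_P_path_class[OF \<gamma>]\<close>)
        (rule Least_le, use zero in \<open>simp add: diag_P_path_class[OF \<gamma>]\<close>)
    then show ?thesis
      using straighten_eq_later[OF \<gamma> _ t, of "m ?c" n] \<open>k \<le> n\<close>
      by (simp add: h_def diag_P_path_class[OF \<gamma>])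
  qed
  have start: "\<gamma> 0 \<in> topspace Y" if "\<gamma> \<in> topspace (path_space Y)" for \<gamma>
    using path_start_continuous that by (auto simp: continuous_map_def)
  have "continuous_map (prod_topology ?I (paths_from UNIV)) Y (\<lambda>(t, \<gamma>). h (t, path_class Y \<gamma>))"
  proof (rule continuous_map_paths_from_locally)
    fix \<gamma> assume "\<gamma> \<in> topspace (paths_from UNIV)"
    then have \<gamma>: "\<gamma> 0 \<in> topspace Y" using start by simp
    obtain N1 k where N1: "openin Y N1" "\<gamma> 0 \<in> N1" "\<forall>x\<in>N1. \<tau> k x = 1" using \<tau>_one[OF \<gamma>] by blast
    obtain N2 l where N2: "openin Y N2" "\<gamma> 0 \<in> N2" "\<forall>n\<ge>l. \<forall>x\<in>N2. \<tau> n x = 0" using \<tau>_zero[OF \<gamma>] by blast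
    \<comment> \<open>Past \<open>Suc k\<close> the choice is continuous over \<open>N1\<close>, and
      past \<open>l\<close> it is stable over \<open>N2\<close>. One fixed stage therefore describes
      \<open>h\<close> over the intersection.\<close>
    let ?N = "N1 \<inter> N2" and ?n = "max (Suc k) l"
    have "continuous_map (prod_topology ?I (paths_from ?N)) Y (\<lambda>(t, \<gamma>). straighten ?n (path_class Y \<gamma>) t)"
      by (rule straighten_continuous[of _ k]) (use N1 N2 in auto)
    then have "continuous_map (prod_topology ?I (paths_from ?N)) Y (\<lambda>(t, \<gamma>). h (t, path_class Y \<gamma>))"
      by (rule continuous_map_eq) (use N2 in \<open>auto intro!: h_eq[of _ l, symmetric]\<close>)
    then show "\<exists>M. openin Y M \<and> \<gamma> 0 \<in> M \<and>
        continuous_map (prod_topology ?I (paths_from (UNIV \<inter> M))) Y (\<lambda>(t, \<gamma>). h (t, path_class Y \<gamma>))"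
      using N1 N2 by (intro exI[of _ ?N]) auto
  qed
  then have "continuous_map (prod_topology ?I (path_space Y)) Y (h \<circ> (\<lambda>(t, \<gamma>). (t, path_class Y \<gamma>)))"
    by (simp add: o_def case_prod_unfold)
  \<comment> \<open>The product of a quotient map with the identity of the interval is again a
    quotient map, as the interval is locally compact Hausdorff. So continuity of \<open>h\<close>
    follows from continuity on path space.\<close>
  moreover have "quotient_map (prod_topology ?I (path_space Y)) (prod_topology ?I (diagonal_cover Y))
      (\<lambda>(t, \<gamma>). (t, path_class Y \<gamma>))"
    unfolding diagonal_cover_def
    by (intro quotient_map_prod_right quotient_map_quotient_topology compact_imp_locally_compact_space)
       (auto simp: compact_space_subtopology Hausdorff_space_subtopology)
  ultimately have "continuous_map (prod_topology ?I (diagonal_cover Y)) Y h"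
    using continuous_compose_quotient_map by blast
  moreover have "h (0, c) = diag_P0 c" "h (1, c) = diag_P1 c" if c: "c \<in> topspace (diagonal_cover Y)" for c
  proof -
    obtain \<gamma> where \<gamma>: "\<gamma> \<in> topspace (path_space Y)" and c: "c = path_class Y \<gamma>"
      using c by (auto simp: diagonal_cover_def)
    show "h (0, c) = diag_P0 c" "h (1, c) = diag_P1 c"
      using path_homotopic_endpoints[OF straighten_homotopic[OF \<gamma>]]
      by (simp_all add: h_def c diag_P_path_class[OF \<gamma>])
  qed
  ultimately show ?thesis
    by (subst homotopic_with) (simp, intro exI[of _ h], simp)
qed

end

text \<open>Assembles the data for the gluing: a contraction of \<open>E\<close>, a section of
  \<open>p\<close> near every point of \<open>Y\<close>, and bump functions subordinate to the
  domains of these sections, reindexed along \<open>z\<close>.\<close>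

theorem diag_P0_P1_homotopic_if_contractible_cover:
  assumes X: "compactly_exhausted Y X" and H: "Hausdorff_space Y" and ne: "topspace Y \<noteq> {}"
    and cov: "covering_map E p Y" and contr: "contractible_space (E :: 'b topology)"
  shows "homotopic_with (\<lambda>_. True) (diagonal_cover Y) Y diag_P0 diag_P1"
proof -
  obtain e0 where "homotopic_with (\<lambda>_. True) E E id (\<lambda>_. e0)"
    using contr unfolding contractible_space_def by blast
  then obtain K :: "real \<times> 'b \<Rightarrow> 'b" where K: "continuous_map (prod_topology (top_of_set {0..1}) E) E K"
    "\<And>e. K (0, e) = e" "\<And>e. K (1, e) = e0"
    unfolding homotopic_with_def by auto
  have "\<exists>U s. openin Y U \<and> y \<in> U \<and> continuous_map (subtopology Y U) E s \<and> (\<forall>u\<in>U. p (s u) = u)"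
    if y: "y \<in> topspace Y" for y
  proof -
    have "p ` topspace E = topspace Y" using cov by (simp add: covering_map_def)
    then obtain e where e: "e \<in> topspace E" "p e = y" using y by (metis imageE)
    obtain U where U: "openin Y U" "y \<in> U"
      and s: "\<And>e. \<lbrakk>e \<in> topspace E; p e \<in> U\<rbrakk> \<Longrightarrow> \<exists>V s. openin E V \<and> e \<in> V \<and>
         continuous_map (subtopology Y U) E s \<and> (\<forall>u\<in>U. p (s u) = u) \<and> (\<forall>v\<in>V. s (p v) = v)"
      using covering_map_local_sections[OF cov y] by metis
    show ?thesis using s[OF e(1)] e(2) U by blast
  qed
  then obtain U \<sigma> where U: "\<And>y. y \<in> topspace Y \<Longrightarrow> openin Y (U y) \<and> y \<in> U y"
    and \<sigma>: "\<And>y. y \<in> topspace Y \<Longrightarrow> continuous_map (subtopology Y (U y)) E (\<sigma> y) \<and> (\<forall>u\<in>U y. p (\<sigma> y u) = u)"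
    by metis
  show ?thesis
  proof (rule compactly_exhausted_locally_finite_bumps[OF X H ne U])
    fix z \<tau> S
    assume z: "\<And>n :: nat. z n \<in> topspace Y"
      and bumps: "\<And>n. continuous_map Y euclideanreal (\<tau> n)" "\<And>n y. \<tau> n y \<in> {0..1}"
      "\<And>n. closedin Y (S n)" "\<And>n. S n \<subseteq> U (z n)" "\<And>n y. y \<in> topspace Y - S n \<Longrightarrow> \<tau> n y = 0"
      "\<And>y. y \<in> topspace Y \<Longrightarrow> \<exists>N n. openin Y N \<and> y \<in> N \<and> (\<forall>x\<in>N. \<tau> n x = 1)"
      "\<And>y. y \<in> topspace Y \<Longrightarrow> \<exists>N m. openin Y N \<and> y \<in> N \<and> (\<forall>n\<ge>m. \<forall>x\<in>N. \<tau> n x = 0)"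
    have U\<sigma>: "\<And>n. openin Y (U (z n))" "\<And>n. continuous_map (subtopology Y (U (z n))) E (\<sigma> (z n))"
      "\<And>n y. y \<in> U (z n) \<Longrightarrow> p (\<sigma> (z n) y) = y"
      using U \<sigma> z by blast+
    have "straightening E p Y K e0 (\<lambda>n. U (z n)) (\<lambda>n. \<sigma> (z n)) \<tau> S"
      by (rule straightening.intro) (assumption | rule cov K U\<sigma> bumps)+
    then show ?thesis by (rule straightening.homotopic_diag_P0_P1)
  qed
qed

theorem proposition3p4:
  fixes Y :: "'a topology"
    and I :: "'i set" and d :: "'i \<Rightarrow> nat" and \<Phi> :: "'i \<Rightarrow> (nat \<Rightarrow> real) \<Rightarrow> 'a"
    and G :: "('g, 'm) monoid_scheme"
  assumes "CW_complex Y I d \<Phi>" and "countable I"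
    and "path_connected_space Y"
    and "K_G_1_space G Y"
  shows "path_representable Y"
proof -
  have H: "Hausdorff_space Y" using assms(1) by (simp add: CW_complex_def)
  obtain X where X: "compactly_exhausted Y X"
    using countable_CW_complex_compactly_exhausted[OF assms(1,2)] by blast
  obtain E :: "(real \<Rightarrow> 'a) set topology" and p where E: "universal_cover E p Y" "contractible_space E"
    using assms(4) unfolding K_G_1_space_def by blast
  \<comment> \<open>The base point of the fundamental group supplies a point of
    \<open>Y\<close>.\<close>
  have "topspace Y \<noteq> {}" using assms(4) unfolding K_G_1_space_def by blast
  then have "homotopic_with (\<lambda>_. True) (diagonal_cover Y) Y diag_P0 diag_P1"
    using diag_P0_P1_homotopic_if_contractible_cover[OF X H] E unfolding universal_cover_def by blast
  then show ?thesis
    unfolding path_representable_def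
    using H E(1) CW_complex_locally_path_connected[OF assms(1)]
      path_connected_imp_connected_space[OF assms(3)] by blast
qed

end
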